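(* Let $f:\mathbb{C}\to\mathbb{C}$ be an entire function with a logarithmic singularity $U: r\mapsto U_r$ over $0$. Then there exists $r_0>0$ such that $U_{r_0}$ is an absorbing set for a parabolic virtual immediate basin of type I for the Newton map $N_f$.
   Context: The Newton map of an entire function $f$ is the meromorphic function $N_f:\mathbb{C}\to\widehat{\mathbb{C}}$, $N_f(z)=z-f(z)/f'(z)$. $B_r(a)$ is the open disk of radius $r$ around $a$; $N_f^{\circ n}$ is the $n$-th iterate; $X$ is $N_f$-invariant if $N_f(X)\subset X$. Singularities. Let $g$ be meromorphic on $\mathbb{C}$ and $a\in\mathbb{C}$. Suppose that for each $r>0$, $U_r$ is a connected component of $g^{-1}(B_r(a))$, with $U_{r_1}\subset U_{r_2}$ whenever $r_1<r_2$. If $\bigcap_{r>0}U_r=\emptyset$, then $U:r\mapsto U_r$ is called a singularity (of $g^{-1}$) over $a$. It is direct if $a\notin g(U_r)$ for some $r>0$. A direct singularity $U$ over $a$ is logarithmic if $g:U_r\to B_r(a)\setminus\{a\}$ is a universal covering map for all sufficiently small $r>0$. Absorbing sets. Let $V$ be a domain invariant under a map $N$. A connected and simply connected open set $A\subset V$ is a weakly absorbing set for $V$ (for $N$) if $N(A)\subset A$ and for each compact $K\subset V$ there is $k\in\mathbb{N}$ with $N^{\circ k}(K)\subset A$. It is an absorbing set if in addition $N(\overline{A})\subset A$, where the closure is taken in $\mathbb{C}$. Virtual immediate basins. A domain $V\subset\mathbb{C}$ is a virtual immediate basin for $N_f$ if it is maximal (among domains in $\mathbb{C}$) with respect to: (1)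 $\lim_{n\to\infty}N_f^{\circ n}(z)=\infty$ for every $z\in V$; (2) $V$ contains an absorbing set. Types. Let $T(z)=z+1$. A conformal conjugacy for $N_f$ on a virtual immediate basin $V$ is a triple $(\Omega,\phi,T)$ where $\Omega\subset\mathbb{C}$ is a $T$-invariant domain and $\phi:V\to\Omega$ is holomorphic with $\phi\circ N_f=T\circ\phi$ on $V$, such that there is a weakly absorbing set $A$ for $V$ on which $\phi$ is univalent and for which $\phi(A)$ is a weakly absorbing set for $T|_\Omega$ in $\Omega$. $V$ is parabolic of type I if it has a conformal conjugacy with $\Omega=\mathbb{C}$. *)

theory Defs
  imports "HOL-Complex_Analysis.Complex_Analysis"
begin

text \<open>
  Meromorphic functions \<open>\<complex> \<rightarrow> \<complex> \<union> {\<infinity>}\<close> are rendered as functions into \<^typ>\<open>complex option\<close>,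
  with \<^term>\<open>None\<close> playing the role of \<open>\<infinity>\<close>. Inclusions \<open>N(X) \<subseteq> Y\<close> with \<open>Y \<subseteq> \<complex>\<close> thus read
  \<open>N ` X \<subseteq> Some ` Y\<close> and entail that \<open>N\<close> has no pole in \<open>X\<close>.
\<close>

text \<open>
  Division by zero makes the naive expression \<open>z - f z / f' z\<close> evaluate to \<open>z\<close> at every critical
  point of \<open>f\<close>. The Newton map is the meromorphic function it represents: poles have value \<open>\<infinity>\<close>,
  and removable singularities (the multiple zeros of \<open>f\<close>) are filled in by continuity.
\<close>
definition newton_map :: "(complex \<Rightarrow> complex) \<Rightarrow> complex \<Rightarrow> complex option" where
  "newton_map f z =
     (if is_pole (\<lambda>w. w - f w / deriv f w) z then None
      else Some (remove_sings (\<lambda>w. w - f w / deriv f w) z))"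

text \<open>An orbit that hits \<open>\<infinity>\<close> stops there: all later iterates are \<^term>\<open>None\<close>.\<close>
primrec iterate :: "(complex \<Rightarrow> complex option) \<Rightarrow> nat \<Rightarrow> complex \<Rightarrow> complex option" where
  "iterate N 0 z = Some z"
| "iterate N (Suc n) z = Option.bind (iterate N n z) N"

definition invariant_under :: "(complex \<Rightarrow> complex option) \<Rightarrow> complex set \<Rightarrow> bool" where
  "invariant_under N X \<longleftrightarrow> N ` X \<subseteq> Some ` X"

definition complex_domain :: "complex set \<Rightarrow> bool" where
  "complex_domain V \<longleftrightarrow> open V \<and> connected V \<and> V \<noteq> {}"

text \<open>
  Singularities of the inverse of \<open>g : \<complex> \<rightarrow> \<complex>\<close> over a finite value \<open>a\<close>; only the values \<open>U r\<close>
  with \<open>r > 0\<close> are relevant.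
\<close>
definition singularity_over ::
    "(complex \<Rightarrow> complex) \<Rightarrow> complex \<Rightarrow> (real \<Rightarrow> complex set) \<Rightarrow> bool" where
  "singularity_over g a U \<longleftrightarrow>
     (\<forall>r>0. U r \<in> components (g -` ball a r)) \<and>
     (\<forall>r1 r2. 0 < r1 \<and> r1 < r2 \<longrightarrow> U r1 \<subseteq> U r2) \<and>
     (\<Inter>r\<in>{0<..}. U r) = {}"

definition direct_singularity ::
    "(complex \<Rightarrow> complex) \<Rightarrow> complex \<Rightarrow> (real \<Rightarrow> complex set) \<Rightarrow> bool" where
  "direct_singularity g a U \<longleftrightarrow> singularity_over g a U \<and> (\<exists>r>0. a \<notin> g ` U r)"

definition universal_covering ::
    "complex set \<Rightarrow> (complex \<Rightarrow> complex) \<Rightarrow> complex set \<Rightarrow> bool" where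
  "universal_covering C p S \<longleftrightarrow> covering_space C p S \<and> connected C \<and> simply_connected C"

definition logarithmic_singularity ::
    "(complex \<Rightarrow> complex) \<Rightarrow> complex \<Rightarrow> (real \<Rightarrow> complex set) \<Rightarrow> bool" where
  "logarithmic_singularity g a U \<longleftrightarrow>
     direct_singularity g a U \<and>
     (\<forall>\<^sub>F r in at_right 0. universal_covering (U r) g (ball a r - {a}))"

definition weakly_absorbing ::
    "(complex \<Rightarrow> complex option) \<Rightarrow> complex set \<Rightarrow> complex set \<Rightarrow> bool" where
  "weakly_absorbing N V A \<longleftrightarrow>
     complex_domain V \<and> invariant_under N V \<and>
     open A \<and> connected A \<and> simply_connected A \<and> A \<subseteq> V \<and>
     invariant_under N A \<and>
     (\<forall>K. compact K \<and> K \<subseteq> V \<longrightarrow> (\<exists>k. iterate N k ` K \<subseteq> Some ` A))"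

definition absorbing ::
    "(complex \<Rightarrow> complex option) \<Rightarrow> complex set \<Rightarrow> complex set \<Rightarrow> bool" where
  "absorbing N V A \<longleftrightarrow> weakly_absorbing N V A \<and> N ` closure A \<subseteq> Some ` A"

definition iterates_tend_to_infinity :: "(complex \<Rightarrow> complex option) \<Rightarrow> complex \<Rightarrow> bool" where
  "iterates_tend_to_infinity N z \<longleftrightarrow>
     (\<forall>n. iterate N n z \<noteq> None) \<and>
     filterlim (\<lambda>n. the (iterate N n z)) at_infinity sequentially"

text \<open>The defining conditions of a virtual immediate basin, without maximality.\<close>
definition pre_virtual_basin :: "(complex \<Rightarrow> complex option) \<Rightarrow> complex set \<Rightarrow> bool" where
  "pre_virtual_basin N V \<longleftrightarrow>
     complex_domain V \<and> (\<forall>z\<in>V. iterates_tend_to_infinity N z) \<and> (\<exists>A. absorbing N V A)"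

definition virtual_immediate_basin :: "(complex \<Rightarrow> complex option) \<Rightarrow> complex set \<Rightarrow> bool" where
  "virtual_immediate_basin N V \<longleftrightarrow>
     pre_virtual_basin N V \<and> (\<forall>W. pre_virtual_basin N W \<and> V \<subseteq> W \<longrightarrow> W = V)"

definition unit_translation :: "complex \<Rightarrow> complex option" where
  "unit_translation z = Some (z + 1)"

definition conformal_conjugacy ::
    "(complex \<Rightarrow> complex option) \<Rightarrow> complex set \<Rightarrow> complex set \<Rightarrow> (complex \<Rightarrow> complex) \<Rightarrow> bool" where
  "conformal_conjugacy N V \<Omega> \<phi> \<longleftrightarrow>
     complex_domain \<Omega> \<and> invariant_under unit_translation \<Omega> \<and>
     \<phi> holomorphic_on V \<and> \<phi> ` V \<subseteq> \<Omega> \<and>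
     (\<forall>z\<in>V. map_option \<phi> (N z) = unit_translation (\<phi> z)) \<and>
     (\<exists>A. weakly_absorbing N V A \<and> inj_on \<phi> A \<and> weakly_absorbing unit_translation \<Omega> (\<phi> ` A))"

definition parabolic_type_I_basin :: "(complex \<Rightarrow> complex option) \<Rightarrow> complex set \<Rightarrow> bool" where
  "parabolic_type_I_basin N V \<longleftrightarrow>
     virtual_immediate_basin N V \<and> (\<exists>\<phi>. conformal_conjugacy N V UNIV \<phi>)"

end

theory Submission
  imports Defs
begin

text \<open>
  On a tract \<open>U r\<close> the function \<open>f\<close> is \<open>exp \<circ> g\<close> for a conformal map \<open>g\<close> onto the half-plane
  \<open>Re w < ln r\<close>, with inverse \<open>\<psi>\<close>. Since \<open>f / f' = 1 / g'\<close>, the Newton map is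
  \<open>\<psi> w \<mapsto> \<psi> w - \<psi>' w\<close>, and Koebe distortion of \<open>\<psi>\<close> on the large disc of radius \<open>R = ln r - Re w\<close>
  shows that in the coordinate \<open>w\<close> it is \<open>h w = w - 1 + O(1/R)\<close>, where the error has derivative
  \<open>O(1/R\<^sup>2)\<close>. As these derivatives are summable along orbits, \<open>h\<close> has a Fatou coordinate
  that is close to \<open>-w\<close>, whose image absorbs all of \<open>\<complex>\<close> under the unit translation.

  Maximality of the basin \<open>V\<close> is the delicate point. Let \<open>W \<supseteq> V\<close> be a competitor with absorbing
  set \<open>B\<close>. If \<open>B = \<complex>\<close>, the Newton map is entire without points of period at most two, hence a
  translation, and \<open>f\<close> is an exponential. Otherwise normalise the Newton map by Riemann maps of \<open>B\<close>
  centred at the points of an orbit \<open>z n = \<psi> (w n)\<close>: the resulting self-maps of the disc fix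
  \<open>0\<close>, and their derivatives there tend to \<open>1\<close> in modulus because the steps of the orbit are small
  compared with its distance from the boundary of \<open>B\<close>. They are therefore eventually univalent on
  any fixed smaller disc, and the growth theorem for their compositions shows that the images of a
  compact set have diameter \<open>O(\<bar>\<psi>' (w n)\<bar>)\<close>. So they end up in the tract.
\<close>

section \<open>Distortion of univalent functions\<close>

text \<open>\<open>Cauchy_inequality\<close> is applied on the circles of radius
  \<open>s < r\<close> and \<open>s\<close> then tends to \<open>r\<close>, so only bounds inside
  the open disc enter. The constant \<open>b\<close> vanishes under a derivative of positive
  order.\<close>

lemma Cauchy_inequality_ball:
  fixes f :: "complex \<Rightarrow> complex"
  assumes f: "f holomorphic_on ball a r" and r: "0 < r"
    and bnd: "\<And>x. x \<in> ball a r \<Longrightarrow> norm (f x - b) \<le> B" and n: "0 < n"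
  shows "norm ((deriv ^^ n) f a) \<le> fact n * B / r ^ n"
proof -
  have ev: "\<forall>\<^sub>F s in at_left r. norm ((deriv ^^ n) f a) \<le> fact n * B / s ^ n"
  proof -
    have "norm ((deriv ^^ n) f a) \<le> fact n * B / s ^ n" if s: "0 < s" "s < r" for s
    proof -
      have sub: "cball a s \<subseteq> ball a r" using s by auto
      have hol: "(\<lambda>x. f x - b) holomorphic_on cball a s"
        by (intro holomorphic_intros holomorphic_on_subset[OF f sub])
      have "norm ((deriv ^^ n) (\<lambda>x. f x - b) a) \<le> fact n * B / s ^ n"
      proof (rule Cauchy_inequality)
        show "(\<lambda>x. f x - b) holomorphic_on ball a s"
          using hol ball_subset_cball holomorphic_on_subset by blast
        show "continuous_on (cball a s) (\<lambda>x. f x - b)"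
          using hol holomorphic_on_imp_continuous_on by blast
        show "norm (f x - b) \<le> B" if "norm (a - x) = s" for x
          using bnd that s by (auto simp: dist_norm)
      qed (use s in auto)
      moreover have "(deriv ^^ n) (\<lambda>x. f x - b) a = (deriv ^^ n) f a - (deriv ^^ n) (\<lambda>x. b) a"
        by (rule higher_deriv_diff[OF f]) (use r in auto)
      ultimately show ?thesis using n by simp
    qed
    then show ?thesis
      unfolding eventually_at_left[OF r] using r by blast
  qed
  have "((\<lambda>s. fact n * B / s ^ n) \<longlongrightarrow> fact n * B / r ^ n) (at_left r)"
    using r by (intro tendsto_intros) auto
  from tendsto_lowerbound[OF this ev] show ?thesis by simp
qed

lemma Schwarz_ball:
  fixes f :: "complex \<Rightarrow> complex"
  assumes f: "f holomorphic_on ball a r" and im: "f ` ball a r \<subseteq> ball (f a) R"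
    and z: "dist a z < r"
  shows "dist (f a) (f z) \<le> R * dist a z / r"
proof -
  have r: "0 < r" using z zero_le_dist[of a z] by linarith
  have R: "0 < R" using im r by (metis centre_in_ball image_subset_iff)
  define F where "F \<equiv> \<lambda>u. (f (a + of_real r * u) - f a) / of_real R"
  have sub: "a + of_real r * u \<in> ball a r" if "norm u < 1" for u
    using that r by (auto simp: dist_norm norm_mult)
  have "F holomorphic_on ball 0 1"
    unfolding F_def
    by (intro holomorphic_intros holomorphic_on_compose_gen[OF _ f, unfolded o_def])
       (use sub R in auto)
  moreover have "F 0 = 0" by (simp add: F_def)
  moreover have "norm (F u) < 1" if "norm u < 1" for u
    using im sub[OF that] R by (auto simp: F_def norm_divide dist_norm norm_minus_commute image_subset_iff)
  moreover have "norm ((z - a) / of_real r) < 1"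
    using z r by (simp add: norm_divide dist_norm norm_minus_commute)
  ultimately have "norm (F ((z - a) / of_real r)) \<le> norm ((z - a) / of_real r)"
    by (rule Schwarz_Lemma(1))
  then show ?thesis
    using r R by (simp add: F_def norm_divide dist_norm norm_minus_commute divide_simps mult.commute)
qed

text \<open>Schottky's explicit bound for a function of modulus 1 at the origin, evaluated at the
  radius \<open>(1 + t) / 2\<close> in place of \<open>t\<close>.\<close>

definition schottky_bound :: "real \<Rightarrow> real" where
  "schottky_bound t = exp (pi * exp (pi * (4 + 12 * ((1 + t) / 2) / (1 - (1 + t) / 2))))"

lemma Schottky_ball:
  assumes h: "h holomorphic_on ball 0 1" and h0: "h 0 = 1"
    and omit: "\<And>z. z \<in> ball 0 1 \<Longrightarrow> h z \<noteq> 0 \<and> h z \<noteq> -1"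
    and t: "0 \<le> t" "t < 1" and z: "norm z \<le> t"
  shows "norm (h z) \<le> schottky_bound t"
proof -
  \<comment> \<open>Dilation by \<open>s\<close> gives a function on the closed disc, as
    \<open>Schottky\<close> requires. By the arithmetic-geometric mean inequality
    \<open>t \<le> s * s\<close>, so \<open>z / s\<close> still has modulus at most
    \<open>s\<close>. The sign in \<open>F\<close> moves the omitted value \<open>-1\<close> to
    \<open>1\<close>.\<close>
  define s where "s = (1 + t) / 2"
  have s: "0 < s" "s < 1" "t \<le> s * s"
    using t sum_squares_bound[of 1 t] by (auto simp: s_def power2_eq_square field_simps)
  define F where "F = (\<lambda>u. - h (of_real s * u))"
  have in1: "of_real s * u \<in> ball (0::complex) 1" if "norm u \<le> 1" for u
  proof -
    have "s * norm u \<le> s * 1" by (rule mult_left_mono) (use that s in auto)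
    then have "s * norm u < 1" using s by linarith
    then show ?thesis using s by (simp add: norm_mult)
  qed
  have "norm (F (z / of_real s)) \<le> exp (pi * exp (pi * (2 + 2 * 1 + 12 * s / (1 - s))))"
  proof (rule Schottky[of F 1 s "z / of_real s"])
    show "F holomorphic_on cball 0 1" unfolding F_def
      by (intro holomorphic_intros holomorphic_on_compose_gen[OF _ h, unfolded o_def])
         (use in1 in auto)
    show "\<not> (F u = 0 \<or> F u = 1)" if "u \<in> cball 0 1" for u
      using omit[OF in1[of u]] that by (simp add: F_def equation_minus_iff)
    have "norm z \<le> s * s" using z s by linarith
    then show "norm (z / of_real s) \<le> s" using s by (simp add: norm_divide divide_simps)
  qed (use s h0 in \<open>auto simp: F_def\<close>)
  moreover have "F (z / of_real s) = - h z" using s by (simp add: F_def)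
  ultimately show ?thesis by (simp add: schottky_bound_def s_def)
qed

text \<open>
  For an omitted value \<open>w\<close>, the square root of \<open>1 - f / w\<close> omits \<open>0\<close>, and by injectivity of \<open>f\<close>
  also \<open>-1\<close>, so that Schottky's theorem applies. This gives Koebe's theorems with poor constants.
\<close>
lemma univalent_omitted_value_bound:
  assumes f: "f holomorphic_on ball 0 1" and inj: "inj_on f (ball 0 1)" and f0: "f 0 = 0"
    and w: "w \<notin> f ` ball 0 1" and t: "0 \<le> t" "t < 1" and z: "norm z \<le> t"
  shows "norm (f z) \<le> norm w * (1 + (schottky_bound t)\<^sup>2)"
proof -
  have w0: "w \<noteq> 0" using w f0 by (metis centre_in_ball image_eqI zero_less_one)
  have ne: "1 - f u / w \<noteq> 0" if "u \<in> ball 0 1" for u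
    using w that w0 by (auto simp: field_simps)
  obtain k where k: "k holomorphic_on ball 0 1" "\<And>u. u \<in> ball 0 1 \<Longrightarrow> exp (k u) = 1 - f u / w"
  proof (rule holomorphic_logarithm_exists[of "ball 0 1" "\<lambda>u. 1 - f u / w" 0])
    show "(\<lambda>u. 1 - f u / w) holomorphic_on ball 0 1" by (intro holomorphic_intros f w0)
  qed (use ne in auto)
  \<comment> \<open>Subtracting \<open>k 0\<close> selects the branch of the square root with value
    1 at the origin.\<close>
  define h where "h = (\<lambda>u. exp ((k u - k 0) / 2))"
  have h2: "h u ^ 2 = 1 - f u / w" if "u \<in> ball 0 1" for u
  proof -
    have "h u ^ 2 = exp (2 * ((k u - k 0) / 2))" by (simp only: h_def exp_double)
    also have "\<dots> = exp (k u) / exp (k 0)"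
      by (metis exp_diff nonzero_mult_div_cancel_left times_divide_eq_right zero_neq_numeral)
    finally show ?thesis using k(2)[OF that] k(2)[of 0] f0 by simp
  qed
  have "norm (h z) \<le> schottky_bound t"
  proof (rule Schottky_ball[OF _ _ _ t z])
    show "h holomorphic_on ball 0 1" unfolding h_def
      by (intro holomorphic_intros k) auto
    show "h 0 = 1" by (simp add: h_def)
    show "h u \<noteq> 0 \<and> h u \<noteq> -1" if u: "u \<in> ball 0 1" for u
    proof (intro conjI notI)
      assume "h u = -1"
      then have "f u = f 0" using h2[OF u] w0 f0 by simp
      then have "u = 0" using inj u by (auto dest: inj_onD)
      with \<open>h u = -1\<close> show False by (simp add: h_def)
    qed (simp add: h_def)
  qed
  moreover have "f z = w * (1 - h z ^ 2)"
    using h2[of z] z t w0 by (simp add: field_simps)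
  ultimately show ?thesis
    using w0 norm_triangle_ineq4[of 1 "h z ^ 2"]
    by (auto simp: norm_mult norm_power intro!: mult_left_mono order.trans[OF norm_triangle_ineq4] power_mono)
qed

text \<open>Takes the place of the sharp constant 1/4 in Koebe's theorem. The factor 2 comes from
  Cauchy's inequality on the disc of radius 1/2.\<close>

definition koebe_radius :: real where
  "koebe_radius = 1 / (2 * (1 + (schottky_bound (1/2))\<^sup>2))"

definition growth_bound :: "real \<Rightarrow> real" where
  "growth_bound t = 2 * (1 + (schottky_bound t)\<^sup>2)"

lemma koebe_radius_pos: "0 < koebe_radius" and koebe_radius_le: "koebe_radius \<le> 1"
proof -
  have "0 < 1 / (2 * (1 + q))" "1 / (2 * (1 + q)) \<le> 1" if "0 \<le> q" for q :: real
    using that by (auto simp: divide_simps)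
  from this[of "(schottky_bound (1/2))\<^sup>2"] show "0 < koebe_radius" "koebe_radius \<le> 1"
    unfolding koebe_radius_def by simp_all
qed

lemma growth_bound_pos: "0 < growth_bound t"
  by (simp add: growth_bound_def add_pos_nonneg)

text \<open>A small omitted value would bound \<open>f\<close> on the disc of radius 1/2, and
  Cauchy's inequality would then make \<open>deriv f 0\<close> too small.\<close>

lemma koebe_unit:
  assumes f: "f holomorphic_on ball 0 1" and inj: "inj_on f (ball 0 1)" and f0: "f 0 = 0"
  shows "ball 0 (koebe_radius * norm (deriv f 0)) \<subseteq> f ` ball 0 1"
proof (rule ccontr)
  assume "\<not> ?thesis"
  then obtain w where w: "w \<notin> f ` ball 0 1" and lt: "norm w < koebe_radius * norm (deriv f 0)"
    by (auto simp: subset_iff)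
  have "norm (f z - 0) \<le> norm w * (1 + (schottky_bound (1/2))\<^sup>2)" if "z \<in> ball 0 (1/2)" for z
    using univalent_omitted_value_bound[OF f inj f0 w, of "1/2" z] that by auto
  then have "norm ((deriv ^^ 1) f 0) \<le> fact 1 * (norm w * (1 + (schottky_bound (1/2))\<^sup>2)) / (1/2) ^ 1"
    by (intro Cauchy_inequality_ball[where b=0] holomorphic_on_subset[OF f]) auto
  then have "norm (deriv f 0) * koebe_radius \<le> (norm w / koebe_radius) * koebe_radius"
    using koebe_radius_pos by (intro mult_right_mono) (auto simp: koebe_radius_def divide_simps mult_ac)
  with lt koebe_radius_pos show False by (simp add: mult_ac)
qed

text \<open>Some value of modulus at most \<open>\<rho> = 2 * norm (deriv f 0)\<close> is omitted:
  otherwise the inverse would map the disc of radius \<open>\<rho>\<close> into the unit disc, and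
  Cauchy's inequality would make its derivative at 0 smaller than
  \<open>1 / norm (deriv f 0)\<close>. The bound for omitted values then applies.\<close>

lemma growth_unit:
  assumes f: "f holomorphic_on ball 0 1" and inj: "inj_on f (ball 0 1)" and f0: "f 0 = 0"
    and t: "0 \<le> t" "t < 1" and z: "norm z \<le> t"
  shows "norm (f z) \<le> growth_bound t * norm (deriv f 0)"
proof -
  obtain g where g: "g holomorphic_on f ` ball 0 1"
    "\<And>z. z \<in> ball 0 1 \<Longrightarrow> deriv f z * deriv g (f z) = 1" "\<And>z. z \<in> ball 0 1 \<Longrightarrow> g (f z) = z"
    using holomorphic_has_inverse[OF f open_ball inj] by metis
  have d0: "deriv f 0 \<noteq> 0" using g(2)[of 0] by auto
  define \<rho> where "\<rho> = 2 * norm (deriv f 0)"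
  have \<rho>: "0 < \<rho>" using d0 by (simp add: \<rho>_def)
  have "\<not> ball 0 \<rho> \<subseteq> f ` ball 0 1"
  proof
    assume sub: "ball 0 \<rho> \<subseteq> f ` ball 0 1"
    have "norm (g x - 0) \<le> 1" if "x \<in> ball 0 \<rho>" for x
    proof -
      have "x \<in> f ` ball 0 1" using sub that by blast
      then obtain u where "u \<in> ball 0 1" "x = f u" by blast
      then show ?thesis using g(3) by auto
    qed
    then have "norm ((deriv ^^ 1) g 0) \<le> fact 1 * 1 / \<rho> ^ 1"
      by (intro Cauchy_inequality_ball[where b=0] holomorphic_on_subset[OF g(1) sub] \<rho>) auto
    moreover have "norm (deriv f 0) * norm (deriv g 0) = 1"
      using g(2)[of 0] f0 by (metis centre_in_ball norm_mult norm_one zero_less_one)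
    then have "norm (deriv g 0) = 1 / norm (deriv f 0)"
      using d0 by (simp add: divide_simps mult.commute)
    ultimately show False using d0 by (simp add: \<rho>_def divide_simps)
  qed
  then obtain w where w: "w \<notin> f ` ball 0 1" "norm w \<le> \<rho>"
    by (auto simp: subset_iff)
  have "norm (f z) \<le> norm w * (1 + (schottky_bound t)\<^sup>2)"
    by (rule univalent_omitted_value_bound[OF f inj f0 w(1) t z])
  also have "\<dots> \<le> \<rho> * (1 + (schottky_bound t)\<^sup>2)"
    by (rule mult_right_mono) (use w in auto)
  finally show ?thesis by (simp add: \<rho>_def growth_bound_def algebra_simps)
qed

lemma
  fixes f :: "complex \<Rightarrow> complex"
  assumes f: "f holomorphic_on ball a R" and inj: "inj_on f (ball a R)" and R: "0 < R"
  shows koebe: "ball (f a) (koebe_radius * R * norm (deriv f a)) \<subseteq> f ` ball a R"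
    and koebe_growth: "\<lbrakk>0 \<le> t; t < 1; dist a z \<le> t * R\<rbrakk> \<Longrightarrow>
           dist (f a) (f z) \<le> growth_bound t * R * norm (deriv f a)"
proof -
  define F where "F = (\<lambda>u. f (a + of_real R * u) - f a)"
  have sub: "a + of_real R * u \<in> ball a R" if "u \<in> ball 0 1" for u
    using that R by (auto simp: dist_norm norm_mult)
  have F: "F holomorphic_on ball 0 1"
    unfolding F_def
    by (intro holomorphic_intros holomorphic_on_compose_gen[OF _ f, unfolded o_def])
       (use sub in auto)
  have "inj_on F (ball 0 1)"
  proof (rule inj_onI)
    fix x y assume xy: "x \<in> ball 0 1" "y \<in> ball 0 1" "F x = F y"
    have "f (a + of_real R * x) = f (a + of_real R * y)" using xy(3) by (simp add: F_def)
    then have "a + of_real R * x = a + of_real R * y"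
      using sub[OF xy(1)] sub[OF xy(2)] by (rule inj_onD[OF inj])
    then show "x = y" using R by simp
  qed
  note F = F this
  have F0: "F 0 = 0" by (simp add: F_def)
  have dF: "deriv F 0 = of_real R * deriv f a"
  proof -
    have fa: "(f has_field_derivative deriv f a) (at (a + of_real R * 0))"
      using holomorphic_derivI[OF f open_ball, of a] R by simp
    have "((\<lambda>u. a + of_real R * u) has_field_derivative of_real R) (at 0)"
      by (auto intro!: derivative_eq_intros)
    from DERIV_chain2[OF fa this] have "(F has_field_derivative deriv f a * of_real R) (at 0)"
      unfolding F_def by (auto intro!: derivative_eq_intros)
    then show ?thesis by (simp add: DERIV_imp_deriv mult.commute)
  qed
  then have nF: "norm (deriv F 0) = R * norm (deriv f a)" using R by (simp add: norm_mult)
  show "ball (f a) (koebe_radius * R * norm (deriv f a)) \<subseteq> f ` ball a R"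
  proof
    fix y assume "y \<in> ball (f a) (koebe_radius * R * norm (deriv f a))"
    then have "y - f a \<in> ball 0 (koebe_radius * norm (deriv F 0))"
      using nF by (simp add: dist_norm norm_minus_commute mult_ac)
    then obtain u where u: "u \<in> ball 0 1" "y - f a = F u" using koebe_unit[OF F F0] by blast
    then show "y \<in> f ` ball a R" using sub[OF u(1)] by (auto simp: F_def)
  qed
  assume t: "0 \<le> t" "t < 1" and z: "dist a z \<le> t * R"
  have "norm ((z - a) / of_real R) \<le> t"
    using z R by (simp add: norm_divide divide_simps dist_norm norm_minus_commute)
  from growth_unit[OF F F0 t this] show "dist (f a) (f z) \<le> growth_bound t * R * norm (deriv f a)"
    using R nF by (simp add: F_def dist_norm norm_minus_commute mult_ac)
qed

section \<open>Perturbations of a translation\<close>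

text \<open>The boundary circle is mapped to points at distance at least \<open>q * r\<close> from
  \<open>F w\<close>, and the image of the open disc is open, so it cannot end before that
  distance.\<close>

lemma ball_subset_image_expanding:
  fixes F :: "complex \<Rightarrow> complex"
  assumes S: "open S" "F holomorphic_on S" "cball w r \<subseteq> S" and r: "0 < r"
    and low: "\<And>x y. \<lbrakk>x \<in> S; y \<in> S\<rbrakk> \<Longrightarrow> q * dist x y \<le> dist (F x) (F y)" and q: "0 < q"
  shows "ball (F w) (q * r) \<subseteq> F ` cball w r"
proof (rule ball_subset_open_map_image)
  have w: "w \<in> S" using S r by auto
  have "F holomorphic_on cball w r" using S holomorphic_on_subset by blast
  then show "continuous_on (closure (cball w r)) F"
    by (simp add: holomorphic_on_imp_continuous_on)
  have "inj_on F S"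
  proof (rule inj_onI)
    fix x y assume "x \<in> S" "y \<in> S" "F x = F y"
    then have "q * dist x y \<le> 0" using low[of x y] by simp
    then show "x = y" using q by (simp add: mult_le_0_iff)
  qed
  moreover have sub: "interior (cball w r) \<subseteq> S" using S interior_subset by blast
  ultimately show "open (F ` interior (cball w r))"
    using S by (meson holomorphic_on_subset inj_on_subset open_interior open_mapping_thm3)
  show "q * r \<le> norm (F z - F w)" if "z \<in> frontier (cball w r)" for z
  proof -
    have "dist w z = r" "z \<in> S" using that S(3) r by auto
    then show ?thesis using low[OF w, of z] by (simp add: dist_norm norm_minus_commute)
  qed
qed (use r q in auto)

lemma real_half_at_top: "filterlim (\<lambda>n. real n / 2) at_top sequentially"
  using filterlim_at_top_mult_tendsto_pos[OF tendsto_const, of "1/2::real"] filterlim_real_sequentially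
  by fastforce

text \<open>The bounds are required on every half-plane \<open>Re w \<le> M - s\<close> because
  \<open>n\<close> steps of an orbit gain the depth \<open>s = n / 2\<close>. The condition
  \<open>6 * \<kappa> + 1/2 \<le> T\<close> keeps the total distortion along an orbit below
  1/2.\<close>

locale near_translation =
  fixes h :: "complex \<Rightarrow> complex" and M T \<kappa> :: real
  assumes hol: "h holomorphic_on {w. Re w < M}"
    and \<kappa>: "0 < \<kappa>" "6 * \<kappa> + 1/2 \<le> T"
    and move: "\<And>w s. \<lbrakk>Re w < M; 0 \<le> s; Re w \<le> M - s\<rbrakk> \<Longrightarrow> norm (h w - w + 1) \<le> \<kappa> / (T + s)"
    and contr: "\<And>w w' s. \<lbrakk>Re w < M; Re w' < M; 0 \<le> s; Re w \<le> M - s; Re w' \<le> M - s\<rbrakk> \<Longrightarrow>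
                  norm ((h w - w) - (h w' - w')) \<le> \<kappa> / (T + s)\<^sup>2 * norm (w - w')"
begin

lemma Re_step:
  assumes "Re w < M"
  shows "Re (h w) \<le> Re w - 1/2"
proof -
  have "\<kappa> / T \<le> 1/2" using \<kappa> by (auto simp: divide_simps)
  moreover have "norm (h w - w + 1) \<le> \<kappa> / T" using move[of w 0] assms by simp
  ultimately have "norm (h w - w + 1) \<le> 1/2" by linarith
  then show ?thesis using complex_Re_le_cmod[of "h w - w + 1"] by simp
qed

lemma Re_iter:
  assumes "Re w < M"
  shows "Re ((h ^^ n) w) \<le> Re w - n / 2"
proof (induction n)
  case (Suc n)
  then have "Re ((h ^^ n) w) < M" using assms by (smt (verit) of_nat_0_le_iff divide_nonneg_pos)
  from Re_step[OF this] Suc show ?case by (simp add: field_simps)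
qed simp

lemma iter_in: "Re w < M \<Longrightarrow> Re ((h ^^ n) w) < M"
  using Re_iter[of w n] by (smt (verit) of_nat_0_le_iff divide_nonneg_pos)

lemma iter_holomorphic: "(h ^^ n) holomorphic_on {w. Re w < M}"
proof (induction n)
  case (Suc n)
  have "h \<circ> (h ^^ n) holomorphic_on {w. Re w < M}"
    by (rule holomorphic_on_compose_gen[OF Suc hol]) (auto simp: iter_in)
  then show ?case by (simp add: o_def)
qed (simp add: id_def)

text \<open>A telescoping majorant of the sum of the Lipschitz constants \<open>\<kappa> / (T + n/2)\<^sup>2\<close> met along orbits.\<close>
definition budget :: "nat \<Rightarrow> real" where
  "budget n = 3 * \<kappa> * (1 / (T - 1/2) - 1 / (T - 1/2 + n / 2))"

lemma budget_0: "budget 0 = 0" by (simp add: budget_def)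

text \<open>The factor 3/2 allows for the expansion of distances by the first \<open>n\<close>
  steps. With \<open>s = T + n / 2\<close>, replacing \<open>s * s\<close> by
  \<open>(s - 1/2) * s\<close> gives partial fractions that are one increment of
  \<open>budget\<close>; hence the shift by 1/2 in its definition.\<close>

lemma budget_Suc: "budget n + 3/2 * (\<kappa> / (T + n / 2)\<^sup>2) \<le> budget (Suc n)"
proof -
  define s where "s = T + n / 2"
  have s: "1/2 < s" using \<kappa> by (simp add: s_def add_pos_nonneg add_strict_increasing2)
  have "3/2 * (\<kappa> / s\<^sup>2) \<le> 3/2 * \<kappa> / ((s - 1/2) * s)"
    using \<kappa> s by (auto simp: power2_eq_square intro!: divide_left_mono mult_right_mono)
  also have "\<dots> = 3 * \<kappa> * (1 / (s - 1/2) - 1 / s)"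
    using s by (simp add: divide_simps)
  also have "\<dots> = budget (Suc n) - budget n"
    by (simp add: budget_def s_def algebra_simps add_divide_distrib)
  finally show ?thesis by (simp add: s_def)
qed

lemma budget_le: "budget n \<le> 1/2"
proof -
  have "budget n \<le> 3 * \<kappa> * (1 / (T - 1/2))"
    unfolding budget_def using \<kappa> by (intro mult_left_mono) auto
  also have "\<dots> \<le> 1/2" using \<kappa> by (auto simp: divide_simps)
  finally show ?thesis .
qed

lemma budget_tendsto: "budget \<longlonglongrightarrow> 3 * \<kappa> * (1 / (T - 1/2) - 0)"
proof -
  have "filterlim (\<lambda>n. T - 1/2 + real n / 2) at_top sequentially"
    by (intro filterlim_tendsto_add_at_top[OF tendsto_const] real_half_at_top)
  then have "(\<lambda>n. 1 / (T - 1/2 + real n / 2)) \<longlonglongrightarrow> 0"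
    by (intro tendsto_divide_0[OF tendsto_const] filterlim_at_top_imp_at_infinity)
  then show ?thesis unfolding budget_def by (intro tendsto_intros)
qed

text \<open>As long as the drift is at most half of \<open>norm (w - w')\<close>, the two orbits are
  at most 3/2 times as far apart as at the start. Then \<open>contr\<close> at depth
  \<open>n / 2\<close> costs no more than one increment of \<open>budget\<close>, and since
  \<open>budget\<close> never exceeds 1/2 the induction continues.\<close>

lemma
  assumes w: "Re w < M" "Re w' < M"
  shows iter_diff: "norm ((h ^^ n) w - (h ^^ n) w' - (w - w')) \<le> budget n * norm (w - w')"
    and iter_diff_step: "norm (((h ^^ Suc n) w - (h ^^ Suc n) w') - ((h ^^ n) w - (h ^^ n) w'))
           \<le> (budget (Suc n) - budget n) * norm (w - w')"
proof -
  have step: "norm (((h ^^ Suc n) w - (h ^^ Suc n) w') - ((h ^^ n) w - (h ^^ n) w'))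
           \<le> (budget (Suc n) - budget n) * norm (w - w')"
    if *: "norm ((h ^^ n) w - (h ^^ n) w' - (w - w')) \<le> budget n * norm (w - w')" for n
  proof -
    let ?a = "(h ^^ n) w" and ?b = "(h ^^ n) w'"
    have "norm (?a - ?b) \<le> norm (w - w') + norm (?a - ?b - (w - w'))"
      by (metis add.commute norm_triangle_sub)
    also have "\<dots> \<le> norm (w - w') + 1/2 * norm (w - w')"
      using * mult_right_mono[OF budget_le[of n] norm_ge_zero[of "w - w'"]] by linarith
    finally have le: "norm (?a - ?b) \<le> 3/2 * norm (w - w')" by simp
    have "norm (((h ^^ Suc n) w - (h ^^ Suc n) w') - (?a - ?b))
        = norm ((h ?a - ?a) - (h ?b - ?b))" by (simp add: algebra_simps)
    also have "\<dots> \<le> \<kappa> / (T + n / 2)\<^sup>2 * norm (?a - ?b)"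
      using Re_iter[of w n] Re_iter[of w' n] w by (intro contr iter_in) auto
    also have "\<dots> \<le> \<kappa> / (T + n / 2)\<^sup>2 * (3/2 * norm (w - w'))"
      using le \<kappa> by (intro mult_left_mono) auto
    also have "\<dots> \<le> (budget (Suc n) - budget n) * norm (w - w')"
      using mult_right_mono[OF budget_Suc[of n] norm_ge_zero[of "w - w'"]] by (simp add: algebra_simps)
    finally show ?thesis .
  qed
  show *: "norm ((h ^^ n) w - (h ^^ n) w' - (w - w')) \<le> budget n * norm (w - w')" for n
  proof (induction n)
    case (Suc n)
    have "norm ((h ^^ Suc n) w - (h ^^ Suc n) w' - (w - w'))
      \<le> norm (((h ^^ Suc n) w - (h ^^ Suc n) w') - ((h ^^ n) w - (h ^^ n) w'))
        + norm ((h ^^ n) w - (h ^^ n) w' - (w - w'))"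
      by (rule order.trans[OF eq_refl norm_triangle_ineq]) (simp add: algebra_simps)
    with step[OF Suc] Suc show ?case by (simp add: algebra_simps)
  qed (simp add: budget_0)
  show "norm (((h ^^ Suc n) w - (h ^^ Suc n) w') - ((h ^^ n) w - (h ^^ n) w'))
           \<le> (budget (Suc n) - budget n) * norm (w - w')"
    by (rule step[OF *])
qed

lemma iter_diff_half:
  assumes "Re w < M" "Re w' < M"
  shows "norm ((h ^^ n) w - (h ^^ n) w' - (w - w')) \<le> norm (w - w') / 2"
  using iter_diff[OF assms, of n] mult_right_mono[OF budget_le[of n] norm_ge_zero[of "w - w'"]] by simp

lemma iter_expand:
  assumes "Re w < M" "Re w' < M"
  shows "norm (w - w') / 2 \<le> norm ((h ^^ n) w - (h ^^ n) w')"
  using iter_diff_half[OF assms, of n] norm_triangle_ineq4[of "(h ^^ n) w - (h ^^ n) w'" "(h ^^ n) w - (h ^^ n) w' - (w - w')"]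
  by simp

text \<open>The coordinate is the limit of \<open>- ((h ^^ n) w - (h ^^ n) w0)\<close>. Deviations
  of single steps from \<open>-1\<close> are only bounded by the divergent series of
  \<open>\<kappa> / (T + n / 2)\<close>, so the orbit of \<open>w0\<close> is subtracted;
  differences of two orbits change by summable increments of \<open>budget\<close>, and the
  Weierstrass test applies. The minus sign turns the step \<open>-1\<close> into
  \<open>+1\<close>.\<close>

lemma fatou_coordinate:
  obtains \<phi> where "\<phi> holomorphic_on {w. Re w < M}"
    "\<And>w. Re w < M \<Longrightarrow> \<phi> (h w) = \<phi> w + 1"
    "\<And>w w'. \<lbrakk>Re w < M; Re w' < M\<rbrakk> \<Longrightarrow> norm (\<phi> w - \<phi> w' + (w - w')) \<le> norm (w - w') / 2"
proof -
  let ?P = "{w. Re w < M}"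
  have opP: "open ?P" by (simp add: open_halfspace_Re_lt)
  define w0 :: complex where "w0 = of_real (M - 1)"
  have w0: "Re w0 < M" by (simp add: w0_def)
  define \<Phi> where "\<Phi> = (\<lambda>n w. - ((h ^^ n) w - (h ^^ n) w0))"
  define \<phi> where "\<phi> = (\<lambda>w. (\<Sum>i. \<Phi> (Suc i) w - \<Phi> i w) + \<Phi> 0 w)"
  have sb: "summable (\<lambda>n. budget (Suc n) - budget n)"
    by (rule telescope_summable[OF budget_tendsto])
  have bnd: "norm (\<Phi> (Suc i) w - \<Phi> i w) \<le> (budget (Suc i) - budget i) * norm (w - w0)"
    if "Re w < M" for i w
  proof -
    have "\<Phi> (Suc i) w - \<Phi> i w = - (((h ^^ Suc i) w - (h ^^ Suc i) w0) - ((h ^^ i) w - (h ^^ i) w0))"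
      by (simp add: \<Phi>_def)
    then show ?thesis using iter_diff_step[OF that w0, of i] by (simp only: norm_minus_cancel)
  qed
  have mono: "0 \<le> budget (Suc i) - budget i" for i
    using budget_Suc[of i] \<kappa> by (smt (verit) divide_nonneg_nonneg mult_nonneg_nonneg zero_le_power2)
  have uni: "uniform_limit (cball x d) \<Phi> \<phi> sequentially" if sub: "cball x d \<subseteq> ?P" and d: "0 < d" for x d
  proof -
    have "uniform_limit (cball x d) (\<lambda>n w. \<Sum>i<n. \<Phi> (Suc i) w - \<Phi> i w) (\<lambda>w. \<Sum>i. \<Phi> (Suc i) w - \<Phi> i w) sequentially"
    proof (rule Weierstrass_m_test)
      fix n w assume w: "w \<in> cball x d"
      have "norm (w - w0) \<le> norm (x - w0) + d"
        using w norm_triangle_ineq[of "w - x" "x - w0"] by (auto simp: dist_norm norm_minus_commute)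
      then show "norm (\<Phi> (Suc n) w - \<Phi> n w) \<le> (budget (Suc n) - budget n) * (norm (x - w0) + d)"
        using order.trans[OF bnd[of w n] mult_left_mono[OF _ mono[of n]]] sub w by auto
    qed (rule summable_mult2[OF sb])
    moreover have "uniform_limit (cball x d) (\<lambda>n w. \<Phi> 0 w) (\<lambda>w. \<Phi> 0 w) sequentially"
      by (rule uniform_limit_const)
    ultimately have "uniform_limit (cball x d) (\<lambda>n w. (\<Sum>i<n. \<Phi> (Suc i) w - \<Phi> i w) + \<Phi> 0 w) \<phi> sequentially"
      unfolding \<phi>_def by (rule uniform_limit_add)
    moreover have "(\<Sum>i<n. \<Phi> (Suc i) w - \<Phi> i w) + \<Phi> 0 w = \<Phi> n w" for n w
      by (subst sum_lessThan_telescope) simp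
    ultimately show ?thesis by simp
  qed
  have ex: "\<exists>d>0. cball x d \<subseteq> ?P" if "Re x < M" for x
    using opP that by (simp add: open_contains_cball)
  have lim: "(\<lambda>n. \<Phi> n w) \<longlonglongrightarrow> \<phi> w" if w: "Re w < M" for w
  proof -
    obtain d where d: "d > 0" "cball w d \<subseteq> ?P" using ex[OF w] by blast
    show ?thesis by (rule tendsto_uniform_limitI[OF uni[OF d(2,1)]]) (use d in auto)
  qed
  show ?thesis
  proof
    show "\<phi> holomorphic_on ?P"
    proof (rule holomorphic_uniform_sequence[OF opP])
      show "\<Phi> n holomorphic_on ?P" for n
        unfolding \<Phi>_def
        by (intro holomorphic_on_minus holomorphic_on_diff holomorphic_on_const iter_holomorphic)
      show "\<exists>d>0. cball x d \<subseteq> ?P \<and> uniform_limit (cball x d) \<Phi> \<phi> sequentially" if "x \<in> ?P" for x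
        using ex[of x] uni that by blast
    qed
    show "norm (\<phi> w - \<phi> w' + (w - w')) \<le> norm (w - w') / 2" if w: "Re w < M" "Re w' < M" for w w'
    proof (rule tendsto_upperbound)
      show "(\<lambda>n. norm (\<Phi> n w - \<Phi> n w' + (w - w'))) \<longlonglongrightarrow> norm (\<phi> w - \<phi> w' + (w - w'))"
        by (intro tendsto_intros lim w)
      have "norm (\<Phi> n w - \<Phi> n w' + (w - w')) = norm ((h ^^ n) w - (h ^^ n) w' - (w - w'))" for n
        by (subst norm_minus_cancel[symmetric]) (simp add: \<Phi>_def algebra_simps)
      then show "\<forall>\<^sub>F n in sequentially. norm (\<Phi> n w - \<Phi> n w' + (w - w')) \<le> norm (w - w') / 2"
        using iter_diff_half[OF w] by simp
    qed simp
    show "\<phi> (h w) = \<phi> w + 1" if w: "Re w < M" for w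
    proof -
      have hw: "Re (h w) < M" using iter_in[OF w, of 1] by simp
      \<comment> \<open>The deviation of a step at depth at least \<open>n / 2\<close>, which tends
        to 0. It is also the defect of the functional equation for \<open>\<Phi> n\<close>.\<close>
      define e where "e = (\<lambda>n. h ((h ^^ n) w) - (h ^^ n) w + 1)"
      have "(\<lambda>n. \<kappa> / (T + real n / 2)) \<longlonglongrightarrow> 0"
        by (intro tendsto_divide_0[OF tendsto_const] filterlim_at_top_imp_at_infinity
            filterlim_tendsto_add_at_top[OF tendsto_const] real_half_at_top)
      then have "e \<longlonglongrightarrow> 0"
      proof (rule Lim_null_comparison[rotated])
        show "\<forall>\<^sub>F n in sequentially. norm (e n) \<le> \<kappa> / (T + real n / 2)"
        proof (intro always_eventually allI)
          fix n
          have "Re ((h ^^ n) w) \<le> M - real n / 2" using Re_iter[OF w, of n] w by linarith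
          then show "norm (e n) \<le> \<kappa> / (T + real n / 2)"
            unfolding e_def by (intro move iter_in w) auto
        qed
      qed
      then have "(\<lambda>n. \<Phi> n w + 1 - e n) \<longlonglongrightarrow> \<phi> w + 1 - 0"
        by (intro tendsto_intros lim w)
      moreover have "\<Phi> n w + 1 - e n = \<Phi> n (h w)" for n
        using funpow_swap1[of h n w] by (simp add: \<Phi>_def e_def)
      ultimately show ?thesis using LIMSEQ_unique[OF lim[OF hw]] by simp
    qed
  qed
qed

lemma norm_deriv_iter_le:
  assumes "Re w < M"
  shows "norm (deriv (h ^^ n) w) \<le> 2"
proof -
  have opP: "open {w. Re w < M}" by (simp add: open_halfspace_Re_lt)
  have "((h ^^ n) has_field_derivative deriv (h ^^ n) w) (at w)"
    using holomorphic_derivI[OF iter_holomorphic opP] assms by simp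
  then have "((\<lambda>x. norm (((h ^^ n) x - (h ^^ n) w) / (x - w))) \<longlongrightarrow> norm (deriv (h ^^ n) w)) (at w)"
    unfolding has_field_derivative_iff by (intro tendsto_norm)
  moreover have "\<forall>\<^sub>F x in at w. norm (((h ^^ n) x - (h ^^ n) w) / (x - w)) \<le> 2"
  proof -
    have "\<forall>\<^sub>F x in at w. x \<in> {w. Re w < M} \<and> x \<noteq> w"
      using eventually_at_topological opP assms by blast
    then show ?thesis
    proof eventually_elim
      case (elim x)
      then have "norm ((h ^^ n) x - (h ^^ n) w) \<le> 2 * norm (x - w)"
        using iter_diff_half[OF _ assms, of x n] norm_triangle_sub[of "(h ^^ n) x - (h ^^ n) w" "x - w"]
        by (smt (verit) mem_Collect_eq norm_ge_zero field_sum_of_halves)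
      then show ?case using elim by (simp add: norm_divide divide_simps)
    qed
  qed
  ultimately show ?thesis by (rule tendsto_upperbound) simp
qed

end

section \<open>Logarithmic tracts\<close>

text \<open>The assumption \<open>closure_sub\<close> records that the tract is a whole component of
  a preimage: images of smaller half-planes do not accumulate at finite points outside it.\<close>

locale log_tract =
  fixes f \<psi> :: "complex \<Rightarrow> complex" and L :: real
  assumes f_hol: "f holomorphic_on UNIV"
    and \<psi>_hol: "\<psi> holomorphic_on {w. Re w < L}"
    and \<psi>_inj: "inj_on \<psi> {w. Re w < L}"
    and f_\<psi>: "Re w < L \<Longrightarrow> f (\<psi> w) = exp w"
    and closure_sub: "L' < L \<Longrightarrow> closure (\<psi> ` {w. Re w < L'}) \<subseteq> \<psi> ` {w. Re w < L}"
begin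

definition S :: "complex set" where "S = \<psi> ` {w. Re w < L}"

definition g :: "complex \<Rightarrow> complex" where "g = inv_into {w. Re w < L} \<psi>"

text \<open>The radius of the disc about \<open>\<psi> w\<close> that Koebe's theorem places in the
  tract, from the largest disc about \<open>w\<close> in the half-plane.\<close>

definition \<delta> :: "complex \<Rightarrow> real" where "\<delta> w = koebe_radius * (L - Re w) * norm (deriv \<psi> w)"

definition \<nu> :: "complex \<Rightarrow> complex" where "\<nu> z = z - f z / deriv f z"

definition h :: "complex \<Rightarrow> complex" where "h w = g (\<nu> (\<psi> w))"

lemma g_\<psi> [simp]: "Re w < L \<Longrightarrow> g (\<psi> w) = w"
  unfolding g_def by (rule inv_into_f_f[OF \<psi>_inj]) simp

lemma \<psi>_in_S: "Re w < L \<Longrightarrow> \<psi> w \<in> S"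
  by (auto simp: S_def)

lemma S_E:
  assumes "z \<in> S"
  shows "Re (g z) < L" "\<psi> (g z) = z"
  using assms by (auto simp: S_def)

lemma open_S: "open S"
  unfolding S_def by (rule open_mapping_thm3[OF \<psi>_hol open_halfspace_Re_lt \<psi>_inj])

lemma g_hol: "g holomorphic_on S"
  and deriv_g: "Re w < L \<Longrightarrow> deriv \<psi> w * deriv g (\<psi> w) = 1"
proof -
  obtain k where k: "k holomorphic_on S" "\<And>w. Re w < L \<Longrightarrow> deriv \<psi> w * deriv k (\<psi> w) = 1"
    "\<And>w. Re w < L \<Longrightarrow> k (\<psi> w) = w"
    using holomorphic_has_inverse[OF \<psi>_hol open_halfspace_Re_lt \<psi>_inj] unfolding S_def by auto
  have eq: "k z = g z" if "z \<in> S" for z using k(3)[of "g z"] S_E[OF that] by simp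
  show "g holomorphic_on S" using k(1) eq holomorphic_cong by blast
  show "deriv \<psi> w * deriv g (\<psi> w) = 1" if "Re w < L"
  proof -
    have "deriv g (\<psi> w) = deriv k (\<psi> w)"
      by (rule complex_derivative_transform_within_open[OF _ k(1) open_S \<psi>_in_S])
         (use \<open>g holomorphic_on S\<close> eq that in auto)
    then show ?thesis using k(2)[OF that] by simp
  qed
qed

lemma deriv_\<psi>_nz: "Re w < L \<Longrightarrow> deriv \<psi> w \<noteq> 0"
  using deriv_g by force

lemma deriv_g_eq: "Re w < L \<Longrightarrow> deriv g (\<psi> w) = 1 / deriv \<psi> w"
  using deriv_g deriv_\<psi>_nz by (simp add: divide_simps mult.commute)

lemma \<delta>_pos: "Re w < L \<Longrightarrow> 0 < \<delta> w"
  using koebe_radius_pos deriv_\<psi>_nz by (simp add: \<delta>_def)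

lemma ball_halfplane: "ball w (L - Re w) \<subseteq> {w. Re w < L}"
proof
  fix u assume "u \<in> ball w (L - Re w)"
  then show "u \<in> {w. Re w < L}"
    using complex_Re_le_cmod[of "u - w"] by (simp add: dist_norm norm_minus_commute)
qed

lemma ball_image: "Re w < L \<Longrightarrow> ball (\<psi> w) (\<delta> w) \<subseteq> \<psi> ` ball w (L - Re w)"
  unfolding \<delta>_def
  by (intro koebe holomorphic_on_subset[OF \<psi>_hol ball_halfplane] inj_on_subset[OF \<psi>_inj ball_halfplane]) simp

lemma ball_sub_S: "Re w < L \<Longrightarrow> ball (\<psi> w) (\<delta> w) \<subseteq> S"
  using ball_image ball_halfplane unfolding S_def by blast

lemma g_ball:
  assumes w: "Re w < L"
  shows "g ` ball (\<psi> w) (\<delta> w) \<subseteq> ball w (L - Re w)"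
proof clarify
  fix z assume "z \<in> ball (\<psi> w) (\<delta> w)"
  then obtain u where u: "u \<in> ball w (L - Re w)" "z = \<psi> u" using ball_image[OF w] by blast
  moreover have "g z = u" using u subsetD[OF ball_halfplane u(1)] by simp
  ultimately show "g z \<in> ball w (L - Re w)" by simp
qed

text \<open>Schwarz's lemma for \<open>g\<close> from the disc of radius \<open>\<delta> w\<close>
  into the disc of radius \<open>L - Re w\<close>; the depth cancels in the quotient of the
  radii.\<close>

lemma g_Lipschitz:
  assumes w: "Re w < L" and z: "dist (\<psi> w) z < \<delta> w"
  shows "dist w (g z) \<le> dist (\<psi> w) z / (koebe_radius * norm (deriv \<psi> w))"
proof -
  have "dist (g (\<psi> w)) (g z) \<le> (L - Re w) * dist (\<psi> w) z / \<delta> w"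
    by (rule Schwarz_ball[OF holomorphic_on_subset[OF g_hol ball_sub_S[OF w]] _ z])
       (use g_ball[OF w] w in auto)
  also have "\<dots> = dist (\<psi> w) z / (koebe_radius * norm (deriv \<psi> w))"
    using w by (simp add: \<delta>_def divide_simps)
  finally show ?thesis using w by simp
qed

text \<open>As \<open>f\<close> is \<open>exp \<circ> g\<close> on the tract, its logarithmic
  derivative is \<open>deriv g\<close>, which has no zeros because \<open>g\<close> is the inverse
  of \<open>\<psi>\<close>.\<close>

lemma f_S:
  assumes z: "z \<in> S"
  shows "f z = exp (g z)" "deriv f z = exp (g z) * deriv g z" "deriv f z \<noteq> 0"
    "f z / deriv f z = 1 / deriv g z"
proof -
  have fz: "f z = exp (g z)" if "z \<in> S" for z
    using f_\<psi>[of "g z"] S_E[OF that] by simp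
  then show "f z = exp (g z)" using z .
  have "(g has_field_derivative deriv g z) (at z)"
    using holomorphic_derivI[OF g_hol open_S z] .
  then have "((\<lambda>x. exp (g x)) has_field_derivative exp (g z) * deriv g z) (at z)"
    by (auto intro!: derivative_eq_intros)
  then have "(f has_field_derivative exp (g z) * deriv g z) (at z)"
    by (rule DERIV_cong_ev[THEN iffD1, rotated -1])
       (use fz z open_S in \<open>auto simp: eventually_nhds\<close>)
  then show df: "deriv f z = exp (g z) * deriv g z" by (rule DERIV_imp_deriv)
  have "deriv g z \<noteq> 0" using deriv_g[of "g z"] S_E[OF z] by auto
  then show "deriv f z \<noteq> 0" "f z / deriv f z = 1 / deriv g z"
    using df fz[OF z] by auto
qed

lemma \<nu>_\<psi>: "Re w < L \<Longrightarrow> \<nu> (\<psi> w) = \<psi> w - deriv \<psi> w"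
  using f_S(4)[OF \<psi>_in_S, of w] by (simp add: \<nu>_def deriv_g_eq)

lemma \<nu>_hol: "\<nu> holomorphic_on S"
  unfolding \<nu>_def
  by (intro holomorphic_intros holomorphic_on_subset[OF f_hol] holomorphic_on_subset[OF holomorphic_deriv[OF f_hol]])
     (auto simp: open_S dest: f_S(3))

lemma norm_deriv2_g:
  assumes w: "Re w < L" and z: "z \<in> cball (\<psi> w) (\<delta> w / 2)"
  shows "norm (deriv (deriv g) z) \<le> 8 * (L - Re w) / (\<delta> w)\<^sup>2"
proof -
  have sub: "ball z (\<delta> w / 2) \<subseteq> ball (\<psi> w) (\<delta> w)"
  proof
    fix y assume "y \<in> ball z (\<delta> w / 2)"
    then show "y \<in> ball (\<psi> w) (\<delta> w)" using z dist_triangle[of "\<psi> w" y z] by simp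
  qed
  \<comment> \<open>Around a point of the half-size disc there is still a disc of radius
    \<open>\<delta> w / 2\<close> on which \<open>g\<close> stays within \<open>L - Re w\<close> of
    \<open>w\<close>.\<close>
  have "norm ((deriv ^^ 2) g z) \<le> fact 2 * (L - Re w) / (\<delta> w / 2) ^ 2"
  proof (rule Cauchy_inequality_ball)
    show "g holomorphic_on ball z (\<delta> w / 2)"
      using holomorphic_on_subset[OF g_hol] sub ball_sub_S[OF w] by blast
    show "norm (g x - w) \<le> L - Re w" if "x \<in> ball z (\<delta> w / 2)" for x
      using g_ball[OF w] sub that by (fastforce simp: dist_norm norm_minus_commute)
  qed (use \<delta>_pos[OF w] in auto)
  then show ?thesis by (simp add: numeral_2_eq_2 power_divide)
qed

text \<open>The Newton step has length \<open>norm (deriv \<psi> w)\<close>, while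
  \<open>\<delta> w\<close> is \<open>koebe_radius * (L - Re w)\<close> times this length.\<close>

lemma dist_\<nu>:
  assumes w: "Re w < L" and R: "2 \<le> koebe_radius * (L - Re w)"
  shows "dist (\<psi> w) (\<nu> (\<psi> w)) \<le> \<delta> w / 2"
  using w mult_right_mono[OF R norm_ge_zero[of "deriv \<psi> w"]] by (simp add: \<nu>_\<psi> dist_norm \<delta>_def)

text \<open>First-order Taylor expansion of \<open>g\<close> at \<open>\<psi> w\<close>: the step
  \<open>- deriv \<psi> w\<close> changes \<open>g\<close> by exactly \<open>-1\<close> to first
  order since \<open>deriv g (\<psi> w)\<close> is \<open>1 / deriv \<psi> w\<close>. In the
  remainder the square of the step length cancels against
  \<open>(\<delta> w)\<^sup>2\<close>.\<close>

lemma h_estimate: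
  assumes w: "Re w < L" and R: "2 \<le> koebe_radius * (L - Re w)"
  shows "norm (h w - w + 1) \<le> 8 / (koebe_radius\<^sup>2 * (L - Re w))"
proof -
  let ?z = "\<psi> w" and ?B = "8 * (L - Re w) / (\<delta> w)\<^sup>2"
  let ?C = "cball ?z (\<delta> w / 2)"
  have CS: "?C \<subseteq> S" using ball_sub_S[OF w] \<delta>_pos[OF w] by (force intro: order.trans[rotated])
  have "norm ((\<lambda>i. (deriv ^^ i) g) 0 (\<nu> ?z) - (\<Sum>i\<le>1. (\<lambda>i. (deriv ^^ i) g) i ?z * (\<nu> ?z - ?z) ^ i / fact i))
      \<le> ?B * norm (\<nu> ?z - ?z) ^ Suc 1 / fact 1"
  proof (rule complex_Taylor[of ?C])
    show "((deriv ^^ i) g has_field_derivative (deriv ^^ Suc i) g x) (at x within ?C)"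
      if "x \<in> ?C" for i x
      using holomorphic_derivI[OF holomorphic_higher_deriv[OF g_hol open_S] open_S, of x i] CS that
      by (auto intro: DERIV_subset has_field_derivative_at_within)
    show "norm ((deriv ^^ Suc 1) g x) \<le> ?B" if "x \<in> ?C" for x
      using norm_deriv2_g[OF w that] by simp
  qed (use dist_\<nu>[OF w R] \<delta>_pos[OF w] in auto)
  moreover have "\<nu> ?z - ?z = - deriv \<psi> w" using w by (simp add: \<nu>_\<psi>)
  moreover have "(\<Sum>i\<le>1. (\<lambda>i. (deriv ^^ i) g) i ?z * (- deriv \<psi> w) ^ i / fact i) = w - 1"
    using w deriv_\<psi>_nz[OF w] by (simp add: deriv_g_eq)
  ultimately have "norm (h w - (w - 1)) \<le> ?B * norm (deriv \<psi> w) ^ 2"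
    by (simp add: h_def numeral_2_eq_2)
  also have "\<dots> = 8 / (koebe_radius\<^sup>2 * (L - Re w))"
    using w deriv_\<psi>_nz[OF w] koebe_radius_pos by (simp add: \<delta>_def divide_simps power2_eq_square)
  finally show ?thesis by (simp add: algebra_simps)
qed

text \<open>On the tract \<open>\<nu> z\<close> is \<open>z - 1 / deriv g z\<close>, with derivative
  \<open>1 + deriv (deriv g) z / (deriv g z)\<^sup>2\<close>. The estimate serves the multipliers of
  the renormalised maps in the maximality proof.\<close>

lemma deriv_\<nu>_estimate:
  assumes w: "Re w < L"
  shows "norm (deriv \<nu> (\<psi> w) - 1) \<le> 8 / (koebe_radius\<^sup>2 * (L - Re w))"
proof -
  let ?z = "\<psi> w"
  have z: "?z \<in> S" by (rule \<psi>_in_S[OF w])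
  have nz: "deriv g ?z \<noteq> 0" using deriv_g[OF w] by auto
  have "(deriv g has_field_derivative deriv (deriv g) ?z) (at ?z)"
    using holomorphic_derivI[OF holomorphic_deriv[OF g_hol open_S] open_S z] .
  then have "((\<lambda>z. z - 1 / deriv g z) has_field_derivative 1 + deriv (deriv g) ?z / (deriv g ?z)\<^sup>2) (at ?z)"
    using nz by (auto intro!: derivative_eq_intros simp: power2_eq_square)
  then have "(\<nu> has_field_derivative 1 + deriv (deriv g) ?z / (deriv g ?z)\<^sup>2) (at ?z)"
    by (rule DERIV_cong_ev[THEN iffD1, rotated -1])
       (use f_S(4) z open_S in \<open>auto simp: eventually_nhds \<nu>_def\<close>)
  then have "deriv \<nu> ?z - 1 = deriv (deriv g) ?z * (deriv \<psi> w)\<^sup>2"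
    using w by (simp add: DERIV_imp_deriv deriv_g_eq power_divide)
  then have "norm (deriv \<nu> ?z - 1) = norm (deriv (deriv g) ?z) * norm (deriv \<psi> w) ^ 2"
    by (simp add: norm_mult norm_power)
  also have "\<dots> \<le> 8 * (L - Re w) / (\<delta> w)\<^sup>2 * norm (deriv \<psi> w) ^ 2"
    by (intro mult_right_mono norm_deriv2_g[OF w]) (use \<delta>_pos[OF w] in auto)
  also have "\<dots> = 8 / (koebe_radius\<^sup>2 * (L - Re w))"
    using w deriv_\<psi>_nz[OF w] koebe_radius_pos by (simp add: \<delta>_def divide_simps power2_eq_square)
  finally show ?thesis .
qed

text \<open>Four times the constant of \<open>h_estimate\<close>: Cauchy's inequality on the disc of
  radius \<open>(L - Re w) / 2\<close>, where the depth may have halved, loses two factors of 2.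
  With \<open>M = L - T\<close>, a point with \<open>Re w \<le> M - s\<close> has depth
  \<open>L - Re w\<close> at least \<open>T + s\<close>.\<close>

definition \<kappa> :: real where "\<kappa> = 32 / koebe_radius\<^sup>2"
definition T :: real where "T = 6 * \<kappa> + 1"
definition M :: real where "M = L - T"

lemma \<kappa>_facts: "0 < \<kappa>" "8 / koebe_radius\<^sup>2 = \<kappa> / 4"
  using koebe_radius_pos by (auto simp: \<kappa>_def)

lemma T_ge: "4 \<le> koebe_radius * T" "0 < T"
proof -
  show "0 < T" using \<kappa>_facts by (simp add: T_def)
  have "koebe_radius * (6 * \<kappa>) = 192 / koebe_radius"
    using koebe_radius_pos by (simp add: \<kappa>_def power2_eq_square)
  also have "\<dots> \<ge> 4" using koebe_radius_pos koebe_radius_le by (simp add: divide_simps)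
  finally show "4 \<le> koebe_radius * T" using koebe_radius_pos by (simp add: T_def algebra_simps)
qed

lemma M_less: "M < L" using T_ge by (simp add: M_def)

text \<open>The half-plane \<open>Re w < L - T / 2\<close> is larger than \<open>Re w < M\<close>
  and contains the discs of radius \<open>(L - Re w) / 2\<close> about the points of the latter,
  which gives room for Cauchy's inequality in \<open>deriv_h_estimate\<close>.\<close>

lemma far_left:
  assumes "Re w < L - T / 2"
  shows "Re w < L" "2 \<le> koebe_radius * (L - Re w)"
proof -
  show "Re w < L" using assms T_ge by linarith
  have "koebe_radius * (T / 2) \<le> koebe_radius * (L - Re w)"
    using assms koebe_radius_pos by (intro mult_left_mono) auto
  then show "2 \<le> koebe_radius * (L - Re w)" using T_ge by linarith
qed

lemma \<nu>_in_S: "Re w < L - T / 2 \<Longrightarrow> \<nu> (\<psi> w) \<in> S"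
  using far_left[of w] dist_\<nu>[of w] \<delta>_pos[of w] ball_sub_S[of w] by fastforce

lemma h_hol: "h holomorphic_on {w. Re w < L - T / 2}"
proof -
  have "(g \<circ> (\<nu> \<circ> \<psi>)) holomorphic_on {w. Re w < L - T / 2}"
  proof (rule holomorphic_on_compose_gen[OF _ g_hol])
    show "(\<nu> \<circ> \<psi>) holomorphic_on {w. Re w < L - T / 2}"
      by (rule holomorphic_on_compose_gen[OF holomorphic_on_subset[OF \<psi>_hol] \<nu>_hol])
         (use far_left \<psi>_in_S in auto)
  qed (use \<nu>_in_S in auto)
  then show ?thesis by (simp add: h_def[abs_def] o_def)
qed

lemma h_move: "Re w < L - T / 2 \<Longrightarrow> norm (h w - w + 1) \<le> \<kappa> / 4 / (L - Re w)"
  using h_estimate[OF far_left, of w] \<kappa>_facts(2) by (simp flip: divide_divide_eq_left)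

lemma deriv_h_estimate:
  assumes w: "Re w < M"
  shows "norm (deriv (\<lambda>w. h w - w) w) \<le> \<kappa> / (L - Re w)\<^sup>2"
proof -
  let ?R = "L - Re w"
  have R: "0 < ?R" "T < ?R" using w M_less by (auto simp: M_def)
  have *: "Re x < L - ?R / 2" if "x \<in> ball w (?R / 2)" for x
    using that complex_Re_le_cmod[of "x - w"] by (simp add: dist_norm norm_minus_commute field_simps)
  have sub: "ball w (?R / 2) \<subseteq> {w. Re w < L - T / 2}"
  proof
    fix x assume "x \<in> ball w (?R / 2)"
    from *[OF this] R show "x \<in> {w. Re w < L - T / 2}" by (simp add: field_simps)
  qed
  have "norm ((deriv ^^ 1) (\<lambda>w. h w - w) w) \<le> fact 1 * (\<kappa> / 4 / (?R / 2)) / (?R / 2) ^ 1"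
  proof (rule Cauchy_inequality_ball)
    show "(\<lambda>w. h w - w) holomorphic_on ball w (?R / 2)"
      by (intro holomorphic_intros holomorphic_on_subset[OF h_hol sub])
    show "norm (h x - x - (-1)) \<le> \<kappa> / 4 / (?R / 2)" if x: "x \<in> ball w (?R / 2)" for x
    proof -
      have "norm (h x - x + 1) \<le> \<kappa> / 4 / (L - Re x)" using h_move sub x by blast
      also have "\<dots> \<le> \<kappa> / 4 / (?R / 2)"
        using *[OF x] R \<kappa>_facts by (intro divide_left_mono mult_pos_pos) (auto simp: field_simps)
      finally show ?thesis by simp
    qed
  qed (use R in auto)
  also have "fact 1 * (\<kappa> / 4 / (r / 2)) / (r / 2) ^ 1 = \<kappa> / r\<^sup>2" for r :: real
    by (simp add: power2_eq_square)
  finally show ?thesis by simp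
qed

sublocale near_translation h M T \<kappa>
proof
  show "h holomorphic_on {w. Re w < M}"
    by (rule holomorphic_on_subset[OF h_hol]) (use T_ge in \<open>auto simp: M_def\<close>)
  show "6 * \<kappa> + 1 / 2 \<le> T" by (simp add: T_def)
  fix w s assume w: "Re w < M" "0 \<le> s" "Re w \<le> M - s"
  have "norm (h w - w + 1) \<le> \<kappa> / 4 / (L - Re w)" using w T_ge by (intro h_move) (simp add: M_def)
  also have "\<dots> \<le> \<kappa> / (T + s)"
    using w \<kappa>_facts T_ge by (intro frac_le) (auto simp: M_def)
  finally show "norm (h w - w + 1) \<le> \<kappa> / (T + s)" .
next
  fix w w' s assume w: "Re w < M" "Re w' < M" "0 \<le> s" "Re w \<le> M - s" "Re w' \<le> M - s"
  define A where "A = {x. Re x < M} \<inter> {x. Re x \<le> M - s}"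
  have "norm ((\<lambda>w. h w - w) w - (\<lambda>w. h w - w) w') \<le> \<kappa> / (T + s)\<^sup>2 * norm (w - w')"
  proof (rule field_differentiable_bound[of A])
    show "convex A" unfolding A_def
      by (intro convex_Int convex_halfspace_Re_lt convex_halfspace_Re_le)
    fix x assume x: "x \<in> A"
    have "(\<lambda>w. h w - w) holomorphic_on {w. Re w < L - T / 2}"
      by (intro holomorphic_intros h_hol)
    then show "((\<lambda>w. h w - w) has_field_derivative deriv (\<lambda>w. h w - w) x) (at x within A)"
      using holomorphic_derivI[OF _ open_halfspace_Re_lt] x T_ge
      by (force simp: A_def M_def intro: has_field_derivative_at_within)
    have "norm (deriv (\<lambda>w. h w - w) x) \<le> \<kappa> / (L - Re x)\<^sup>2"
      by (rule deriv_h_estimate) (use x in \<open>auto simp: A_def\<close>)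
    also have "\<dots> \<le> \<kappa> / (T + s)\<^sup>2"
      using x w \<kappa>_facts T_ge by (intro divide_left_mono power_mono mult_pos_pos) (auto simp: A_def M_def)
    finally show "norm (deriv (\<lambda>w. h w - w) x) \<le> \<kappa> / (T + s)\<^sup>2" .
  qed (use w in \<open>auto simp: A_def\<close>)
  then show "norm ((h w - w) - (h w' - w')) \<le> \<kappa> / (T + s)\<^sup>2 * norm (w - w')" by simp
qed (rule \<kappa>_facts(1))

lemma \<psi>_h: "Re w < L - T / 2 \<Longrightarrow> \<nu> (\<psi> w) = \<psi> (h w)"
  using S_E(2)[OF \<nu>_in_S, of w] by (simp add: h_def)

lemma M_far: "M < L - T / 2"
  using T_ge by (simp add: M_def)

end

section \<open>Basins of partial maps\<close>

lemma iterate_add: "iterate N (m + n) z = Option.bind (iterate N n z) (iterate N m)"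
  by (induction m) (auto simp: bind_assoc split: Option.bind_splits)

lemma iterate_invariant:
  assumes "invariant_under N X" "z \<in> X"
  shows "\<exists>y\<in>X. iterate N n z = Some y"
proof (induction n)
  case (Suc n)
  then obtain y where "y \<in> X" "iterate N n z = Some y" by blast
  with assms(1) show ?case by (auto simp: invariant_under_def)
qed (use assms in auto)

lemma iterate_funpow:
  assumes "invariant_under N X" "\<And>z. z \<in> X \<Longrightarrow> N z = Some (k z)" "z \<in> X"
  shows "iterate N n z = Some ((k ^^ n) z)"
proof (induction n)
  case (Suc n)
  with iterate_invariant[OF assms(1,3), of n] assms(2) show ?case by auto
qed simp

definition reach :: "(complex \<Rightarrow> complex option) \<Rightarrow> complex set \<Rightarrow> nat \<Rightarrow> complex set" where
  "reach N A n = {z. iterate N n z \<in> Some ` A}"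

text \<open>When the sets \<open>reach N A n\<close> are open and increasing, this is the component
  containing \<open>a\<close> of the set of all points that eventually enter \<open>A\<close>.
  Written as an increasing union, it gives compact subsets a common entry time.\<close>

definition basin :: "(complex \<Rightarrow> complex option) \<Rightarrow> complex set \<Rightarrow> complex \<Rightarrow> complex set" where
  "basin N A a = (\<Union>n. connected_component_set (reach N A n) a)"

lemma reach_mono:
  assumes "invariant_under N A" "m \<le> n"
  shows "reach N A m \<subseteq> reach N A n"
proof
  fix z assume "z \<in> reach N A m"
  then obtain y where y: "y \<in> A" "iterate N m z = Some y" by (auto simp: reach_def)
  obtain y' where "y' \<in> A" "iterate N (n - m) y = Some y'"
    using iterate_invariant[OF assms(1) y(1)] by blast
  then have "y' \<in> A" "iterate N n z = Some y'"
    using iterate_add[of N "n - m" m z] assms(2) y(2) by auto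
  then show "z \<in> reach N A n" by (auto simp: reach_def)
qed

lemma reach_0 [simp]: "reach N A 0 = A"
  by (auto simp: reach_def)

lemma connected_sub_basin:
  assumes "connected K" "a \<in> K" "K \<subseteq> reach N A n"
  shows "K \<subseteq> basin N A a"
  using connected_component_maximal[OF assms(2,1,3)] by (auto simp: basin_def)

locale partial_holomorphic =
  fixes N :: "complex \<Rightarrow> complex option"
  assumes dom_open: "open {z. N z \<noteq> None}"
    and N_hol: "(\<lambda>z. the (N z)) holomorphic_on {z. N z \<noteq> None}"
begin

lemma
  shows open_iterate: "open {z. iterate N n z \<noteq> None}" (is "open (?D n)")
    and iterate_hol: "(\<lambda>z. the (iterate N n z)) holomorphic_on {z. iterate N n z \<noteq> None}"
proof -
  have "open (?D n) \<and> (\<lambda>z. the (iterate N n z)) holomorphic_on ?D n"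
  proof (induction n)
    case (Suc n)
    let ?F = "\<lambda>z. the (iterate N n z)"
    have eq: "?D (Suc n) = ?D n \<inter> ?F -` {z. N z \<noteq> None}"
      by (auto simp: Option.bind_eq_Some_conv)
    have "(\<lambda>z. the (N z)) \<circ> ?F holomorphic_on ?D (Suc n)"
      by (rule holomorphic_on_compose_gen[OF holomorphic_on_subset[OF conjunct2[OF Suc]] N_hol])
         (auto simp: Option.bind_eq_Some_conv)
    moreover have "((\<lambda>z. the (N z)) \<circ> ?F) z = the (iterate N (Suc n) z)" if "z \<in> ?D (Suc n)" for z
      using that by (auto split: Option.bind_splits)
    moreover have "open (?D (Suc n))"
      unfolding eq using Suc dom_open
      by (intro continuous_open_preimage holomorphic_on_imp_continuous_on) auto
    ultimately show ?case using holomorphic_cong by (metis (no_types, lifting))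
  qed auto
  then show "open (?D n)" "(\<lambda>z. the (iterate N n z)) holomorphic_on ?D n" by auto
qed

lemma open_reach:
  assumes "open A"
  shows "open (reach N A n)"
proof -
  have "reach N A n = {z. iterate N n z \<noteq> None} \<inter> (\<lambda>z. the (iterate N n z)) -` A"
    by (force simp: reach_def)
  then show ?thesis
    using continuous_open_preimage[OF holomorphic_on_imp_continuous_on[OF iterate_hol] open_iterate assms]
    by simp
qed

lemma reach_hol: "(\<lambda>z. the (iterate N n z)) holomorphic_on reach N A n"
  by (rule holomorphic_on_subset[OF iterate_hol]) (auto simp: reach_def)

end

locale absorbing_seed = partial_holomorphic +
  fixes A :: "complex set" and a :: complex
  assumes A_open: "open A" and A_conn: "connected A" and A_sc: "simply_connected A"
    and a_in: "a \<in> A" and A_inv: "invariant_under N A"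
begin

abbreviation "V \<equiv> basin N A a"

lemma component_mono: "m \<le> n \<Longrightarrow> connected_component_set (reach N A m) a \<subseteq> connected_component_set (reach N A n) a"
  by (intro connected_component_mono reach_mono A_inv)

lemma A_sub_reach: "A \<subseteq> reach N A n"
  using reach_mono[OF A_inv, of 0 n] by simp

lemma A_sub_comp: "A \<subseteq> connected_component_set (reach N A n) a"
  by (rule connected_component_maximal[OF a_in A_conn A_sub_reach])

lemma A_sub_V: "A \<subseteq> V" using A_sub_comp by (auto simp: basin_def)

lemma V_reach: "z \<in> V \<Longrightarrow> \<exists>n. z \<in> reach N A n"
  using connected_component_subset by (fastforce simp: basin_def)

lemma V_open: "open V"
  unfolding basin_def by (intro open_UN ballI open_connected_component open_reach A_open)

lemma V_conn: "connected V"
proof -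
  have "a \<in> (\<Inter>n. connected_component_set (reach N A n) a)" using A_sub_comp a_in by blast
  then have "(\<Inter>n. connected_component_set (reach N A n) a) \<noteq> {}" by blast
  then show ?thesis unfolding basin_def by (intro connected_Union) auto
qed

lemma V_domain: "complex_domain V"
  using V_open V_conn A_sub_V a_in by (auto simp: complex_domain_def)

text \<open>The map sends the component in \<open>reach N A (Suc n)\<close> onto a connected subset
  of \<open>reach N A n\<close> that meets \<open>A\<close>.\<close>

lemma V_inv: "invariant_under N V"
proof -
  have "N z \<in> Some ` V" if "z \<in> connected_component_set (reach N A n) a" for z n
  proof -
    let ?C = "connected_component_set (reach N A (Suc n)) a" and ?F = "\<lambda>z. the (N z)"
    have C: "?C \<subseteq> reach N A (Suc n)" by (rule connected_component_subset)
    have iter: "iterate N (Suc n) x = Option.bind (N x) (iterate N n)" for x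
      using iterate_add[of N n 1 x] by simp
    have dom: "N x = Some (?F x)" "?F x \<in> reach N A n" if "x \<in> reach N A (Suc n)" for x
      using that iter[of x] unfolding reach_def by (cases "N x"; force)+
    have "?C \<subseteq> {z. N z \<noteq> None}" using C dom by fastforce
    then have "connected (?F ` ?C)"
      by (intro connected_continuous_image connected_connected_component
          holomorphic_on_imp_continuous_on holomorphic_on_subset[OF N_hol])
    moreover have "a \<in> ?C" using A_sub_comp a_in by blast
    moreover have "?F a \<in> A" using A_inv a_in by (force simp: invariant_under_def)
    \<comment> \<open>The image contains \<open>N a\<close>, which lies in \<open>A\<close> but may
      differ from \<open>a\<close>; adjoining \<open>A\<close> brings in the base point.\<close>
    ultimately have "connected (?F ` ?C \<union> A)"
      by (intro connected_Un A_conn) blast+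
    moreover have "?F ` ?C \<union> A \<subseteq> reach N A n" using dom(2) C A_sub_reach by blast
    ultimately have "?F ` ?C \<union> A \<subseteq> V"
      using connected_sub_basin a_in by blast
    moreover have "z \<in> ?C" using that component_mono[of n "Suc n"] by auto
    ultimately show ?thesis using dom(1) C by (metis UnCI image_eqI subsetD)
  qed
  then show ?thesis by (auto simp: invariant_under_def basin_def)
qed

lemma V_compact:
  assumes "compact K" "K \<subseteq> V"
  shows "\<exists>n. iterate N n ` K \<subseteq> Some ` A"
proof -
  let ?C = "\<lambda>n. connected_component_set (reach N A n) a"
  obtain F where F: "finite F" "K \<subseteq> (\<Union>n\<in>F. ?C n)"
  proof (rule compactE_image[OF assms(1), of UNIV ?C])
    show "open (?C n)" for n by (intro open_connected_component open_reach A_open)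
  qed (use assms in \<open>auto simp: basin_def\<close>)
  have "?C n \<subseteq> ?C (Max F)" if "n \<in> F" for n by (rule component_mono) (use that F in auto)
  then have "K \<subseteq> reach N A (Max F)"
    using F connected_component_subset by blast
  then show ?thesis by (auto simp: reach_def)
qed

lemma V_weakly_absorbing: "weakly_absorbing N V A"
  unfolding weakly_absorbing_def
  using V_domain V_inv V_compact A_open A_conn A_sc A_sub_V A_inv by blast

text \<open>A path in \<open>W\<close> from \<open>a\<close> to \<open>z\<close> is compact, so it
  lies in a single \<open>reach N A n\<close>; being connected and containing \<open>a\<close>, it
  lies in the component.\<close>

lemma V_maximal:
  assumes W: "complex_domain W" and sub: "V \<subseteq> W"
    and absorb: "\<And>K. \<lbrakk>compact K; connected K; a \<in> K; K \<subseteq> W\<rbrakk> \<Longrightarrow> \<exists>n. iterate N n ` K \<subseteq> Some ` A"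
  shows "W = V"
proof (intro equalityI sub subsetI)
  fix z assume z: "z \<in> W"
  have "a \<in> W" using sub A_sub_V a_in by blast
  moreover have "path_connected W"
    using W connected_open_path_connected by (auto simp: complex_domain_def)
  ultimately obtain p where p: "path p" "path_image p \<subseteq> W" "pathstart p = a" "pathfinish p = z"
    using z unfolding path_connected_def by blast
  then obtain n where "iterate N n ` path_image p \<subseteq> Some ` A"
    using absorb[of "path_image p"]
    by (metis compact_path_image connected_path_image pathstart_in_path_image)
  then have "path_image p \<subseteq> V"
    using p by (intro connected_sub_basin[of _ _ _ _ n]) (auto simp: reach_def)
  then show "z \<in> V" using p pathfinish_in_path_image by blast
qed

lemma V_tends:
  assumes "\<And>z. z \<in> A \<Longrightarrow> iterates_tend_to_infinity N z" "z \<in> V"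
  shows "iterates_tend_to_infinity N z"
proof -
  obtain n where "z \<in> reach N A n" using V_reach[OF assms(2)] by blast
  then obtain y where y: "y \<in> A" "iterate N n z = Some y" by (auto simp: reach_def)
  have "filterlim (\<lambda>m. the (iterate N m y)) at_infinity sequentially"
    using assms(1)[OF y(1)] by (simp add: iterates_tend_to_infinity_def)
  then have "filterlim (\<lambda>m. the (iterate N (m + n) z)) at_infinity sequentially"
    using y by (simp add: iterate_add)
  then have "filterlim (\<lambda>m. the (iterate N m z)) at_infinity sequentially"
    unfolding filterlim_iff
    using eventually_sequentially_seg[of "\<lambda>m. P (the (iterate N m z))" n for P] by metis
  moreover have "iterate N m z \<noteq> None" for m
    using iterate_invariant[OF V_inv assms(2), of m] by auto
  ultimately show ?thesis by (simp add: iterates_tend_to_infinity_def)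
qed

text \<open>Pull back by iterates: \<open>\<phi>\<close> at the \<open>n\<close>-th iterate, minus
  \<open>n\<close>, does not depend on \<open>n\<close> once the orbit has entered \<open>A\<close>.
  Each such formula is holomorphic on the open set \<open>reach N A n\<close>, so the choice of the
  least entry time does no harm to holomorphy.\<close>

lemma conjugacy_extends:
  assumes \<phi>: "\<phi> holomorphic_on A" and eq: "\<And>z. z \<in> A \<Longrightarrow> \<phi> (the (N z)) = \<phi> z + 1"
  obtains \<Phi> where "\<Phi> holomorphic_on V" "\<And>z. z \<in> V \<Longrightarrow> \<Phi> (the (N z)) = \<Phi> z + 1"
    "\<And>z. z \<in> A \<Longrightarrow> \<Phi> z = \<phi> z"
proof -
  have shift: "\<phi> (the (iterate N n z)) = \<phi> z + of_nat n" if "z \<in> A" for n z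
  proof (induction n)
    case (Suc n)
    then show ?case using iterate_invariant[OF A_inv that, of n] eq by auto
  qed simp
  define \<Phi> where "\<Phi> z = \<phi> (the (iterate N (LEAST n. z \<in> reach N A n) z)) - of_nat (LEAST n. z \<in> reach N A n)" for z
  have \<Phi>: "\<Phi> z = \<phi> (the (iterate N n z)) - of_nat n" if z: "z \<in> reach N A n" for n z
  proof -
    define m where "m = (LEAST n. z \<in> reach N A n)"
    have m: "z \<in> reach N A m" "m \<le> n" unfolding m_def using z by (auto intro: LeastI Least_le)
    then obtain y where y: "y \<in> A" "iterate N m z = Some y" by (auto simp: reach_def)
    have "iterate N n z = iterate N (n - m) y" using iterate_add[of N "n - m" m z] m(2) y(2) by simp
    then have "\<phi> (the (iterate N n z)) - of_nat n = \<phi> y + of_nat (n - m) - of_nat n" using shift[OF y(1), of "n - m"] by simp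
    also have "\<dots> = \<phi> y - of_nat m" using m(2) by (simp add: of_nat_diff)
    finally show ?thesis using y(2) by (simp add: \<Phi>_def m_def)
  qed
  show ?thesis
  proof
    have "\<Phi> holomorphic_on (\<Union>n. reach N A n)"
    proof (rule holomorphic_on_UN_open)
      fix n
      have "\<phi> \<circ> (\<lambda>z. the (iterate N n z)) holomorphic_on reach N A n"
        by (rule holomorphic_on_compose_gen[OF reach_hol \<phi>]) (auto simp: reach_def)
      then have "(\<lambda>z. \<phi> (the (iterate N n z)) - of_nat n) holomorphic_on reach N A n"
        unfolding o_def by (intro holomorphic_intros)
      then show "\<Phi> holomorphic_on reach N A n" using \<Phi> holomorphic_cong by (metis (no_types, lifting))
    qed (use open_reach[OF A_open] in auto)
    then show "\<Phi> holomorphic_on V" by (rule holomorphic_on_subset) (use V_reach in auto)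
    show "\<Phi> z = \<phi> z" if "z \<in> A" for z using \<Phi>[of z 0] that by simp
    fix z assume z: "z \<in> V"
    obtain y where y: "N z = Some y" "y \<in> V" using V_inv z by (force simp: invariant_under_def)
    then obtain n where n: "y \<in> reach N A n" using V_reach by blast
    have it: "iterate N (Suc n) z = iterate N n y" using iterate_add[of N n 1 z] y by simp
    then have "z \<in> reach N A (Suc n)" using n by (simp only: reach_def mem_Collect_eq)
    from \<Phi>[OF this] \<Phi>[OF n] show "\<Phi> (the (N z)) = \<Phi> z + 1" unfolding it using y by simp
  qed
qed

end

section \<open>The Newton map as a partial holomorphic map\<close>

lemma newton_map_local:
  assumes f: "f holomorphic_on UNIV" and z: "newton_map f z \<noteq> None"
  shows "\<exists>B. open B \<and> z \<in> B \<and> B \<subseteq> {z. newton_map f z \<noteq> None} \<and> (\<lambda>z. the (newton_map f z)) holomorphic_on B"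
proof -
  let ?q = "\<lambda>w. w - f w / deriv f w"
  have "f meromorphic_on UNIV" "deriv f meromorphic_on UNIV"
    using f holomorphic_deriv[OF f open_UNIV]
    by (auto intro!: analytic_on_imp_meromorphic_on simp: analytic_on_open)
  then have q: "?q meromorphic_on UNIV" by (intro meromorphic_intros)
  \<comment> \<open>The singularity at \<open>z\<close> is isolated and not essential, so outside
    the poles a finite limit exists and \<open>remove_sings\<close> is analytic there.\<close>
  have iso: "isolated_singularity_at ?q z" using q by (rule meromorphic_on_isolated_singularity[OF meromorphic_on_subset]) auto
  have "not_essential ?q z" using q by (rule meromorphic_on_not_essential[OF meromorphic_on_subset]) auto
  moreover have np: "\<not> is_pole ?q z" using z by (auto simp: newton_map_def)
  ultimately obtain c where "?q \<midarrow>z\<rightarrow> c" by (auto simp: not_essential_def)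
  then have "remove_sings ?q analytic_on {z}" by (rule remove_sings_analytic_at[OF iso])
  then obtain B1 where B1: "open B1" "z \<in> B1" "remove_sings ?q holomorphic_on B1" by (auto simp: analytic_at)
  \<comment> \<open>A disc isolating \<open>z\<close> contains no pole at all, so on it
    \<open>newton_map\<close> takes the second branch of its definition.\<close>
  obtain r where r: "r > 0" "?q analytic_on ball z r - {z}" using iso by (auto simp: isolated_singularity_at_def)
  have np': "\<not> is_pole ?q w" if "w \<in> ball z r" for w
  proof (cases "w = z")
    case False
    then have "?q analytic_on {w}" using that by (intro analytic_on_subset[OF r(2)]) auto
    then show ?thesis by (rule analytic_at_imp_no_pole)
  qed (use np in simp)
  define B where "B = B1 \<inter> ball z r"
  have "the (newton_map f w) = remove_sings ?q w" "newton_map f w \<noteq> None" if "w \<in> B" for w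
    using np'[of w] that by (auto simp: newton_map_def B_def)
  moreover have "remove_sings ?q holomorphic_on B" using B1(3) by (rule holomorphic_on_subset) (auto simp: B_def)
  ultimately have "(\<lambda>z. the (newton_map f z)) holomorphic_on B" "B \<subseteq> {z. newton_map f z \<noteq> None}"
    using holomorphic_cong by (metis (no_types, lifting), blast)
  moreover have "open B" "z \<in> B" using B1 r by (auto simp: B_def)
  ultimately show ?thesis by blast
qed

lemma partial_holomorphic_newton_map:
  assumes f: "f holomorphic_on UNIV"
  shows "partial_holomorphic (newton_map f)"
proof
  let ?D = "{z. newton_map f z \<noteq> None}"
  note loc = newton_map_local[OF f]
  show op: "open ?D" by (subst open_subopen) (use loc in blast)
  show "(\<lambda>z. the (newton_map f z)) holomorphic_on ?D"
  proof -
    have "(\<lambda>z. the (newton_map f z)) field_differentiable at z" if z: "z \<in> ?D" for z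
      using loc[of z] z holomorphic_on_imp_differentiable_at by blast
    then show ?thesis by (simp add: holomorphic_on_def field_differentiable_at_within)
  qed
qed

lemma newton_map_regular:
  assumes f: "f holomorphic_on UNIV" and z: "deriv f z \<noteq> 0"
  shows "newton_map f z = Some (z - f z / deriv f z)"
proof -
  have "f analytic_on {z}" using f by (auto simp: analytic_at)
  then have "(\<lambda>w. w - f w / deriv f w) analytic_on {z}"
    using z by (intro analytic_intros) auto
  then show ?thesis by (simp add: newton_map_def analytic_at_imp_no_pole)
qed

lemma simply_connected_injective_holomorphic_image:
  assumes "open S" "simply_connected S" "f holomorphic_on S" "inj_on f S"
  shows "simply_connected (f ` S)"
proof (rule homeomorphic_simply_connected[OF _ assms(2)])
  show "S homeomorphic f ` S"
    by (rule invariance_of_domain_homeomorphic) (use assms holomorphic_on_imp_continuous_on in auto)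
qed

section \<open>The basin of a logarithmic tract and its conjugacy to a translation\<close>

context log_tract
begin

text \<open>The part of the tract lying over the disc of radius \<open>exp M\<close>; it turns out
  to be \<open>U (exp M)\<close>.\<close>

definition A :: "complex set" where "A = \<psi> ` {w. Re w < M}"

definition w0 :: complex where "w0 = of_real (M - 1)"

definition z0 :: complex where "z0 = \<psi> w0"

lemma Re_w0: "Re w0 < M" "Re w0 = M - 1" by (simp_all add: w0_def)

lemma newton_map_S: "z \<in> S \<Longrightarrow> newton_map f z = Some (\<nu> z)"
  using newton_map_regular[OF f_hol] f_S(3) by (simp add: \<nu>_def)

lemma newton_map_A: "Re w < M \<Longrightarrow> newton_map f (\<psi> w) = Some (\<psi> (h w))"
  using newton_map_S[OF \<psi>_in_S, of w] \<psi>_h[of w] M_less M_far by simp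

lemma A_sub_S: "A \<subseteq> S" using M_less by (auto simp: A_def S_def)

lemma in_A_iff: "z \<in> A \<longleftrightarrow> z \<in> S \<and> Re (g z) < M"
  using M_less by (force simp: A_def S_def)

lemma \<psi>_hol_M: "\<psi> holomorphic_on {w. Re w < M}"
  by (rule holomorphic_on_subset[OF \<psi>_hol]) (use M_less in auto)

lemma \<psi>_inj_M: "inj_on \<psi> {w. Re w < M}"
  by (rule inj_on_subset[OF \<psi>_inj]) (use M_less in auto)

lemma iterate_A: "Re w < M \<Longrightarrow> iterate (newton_map f) n (\<psi> w) = Some (\<psi> ((h ^^ n) w))"
  by (induction n) (auto simp: newton_map_A iter_in)

sublocale seed: absorbing_seed "newton_map f" A z0
proof (intro absorbing_seed.intro partial_holomorphic_newton_map f_hol absorbing_seed_axioms.intro)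
  show "open A" unfolding A_def by (rule open_mapping_thm3[OF \<psi>_hol_M open_halfspace_Re_lt \<psi>_inj_M])
  show "connected A" unfolding A_def
    by (intro connected_continuous_image holomorphic_on_imp_continuous_on \<psi>_hol_M
        convex_connected convex_halfspace_Re_lt)
  show "simply_connected A" unfolding A_def
    by (intro simply_connected_injective_holomorphic_image open_halfspace_Re_lt \<psi>_hol_M \<psi>_inj_M
        convex_imp_simply_connected convex_halfspace_Re_lt)
  show "z0 \<in> A" using Re_w0 by (auto simp: A_def z0_def)
  show "invariant_under (newton_map f) A"
    using newton_map_A iter_in[of _ 1] by (auto simp: A_def invariant_under_def)
qed

text \<open>\<open>closure_sub\<close> keeps limit points inside the tract, and the inequality
  \<open>norm (f z) \<le> exp M\<close> passes to limits.\<close>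

lemma closure_A:
  assumes "z \<in> closure A"
  shows "z \<in> S" "Re (g z) \<le> M"
proof -
  show z: "z \<in> S" using closure_sub[OF M_less] assms unfolding A_def S_def by blast
  have "closed {z. norm (f z) \<le> exp M}"
    using holomorphic_on_imp_continuous_on[OF f_hol] by (intro closed_Collect_le continuous_intros) auto
  moreover have "A \<subseteq> {z. norm (f z) \<le> exp M}"
    using f_\<psi> M_less by (force simp: A_def)
  ultimately have "norm (f z) \<le> exp M" using closure_minimal assms by blast
  then show "Re (g z) \<le> M" using f_S(1)[OF z] by simp
qed

lemma absorbing_A: "absorbing (newton_map f) seed.V A"
  unfolding absorbing_def
proof (intro conjI seed.V_weakly_absorbing subsetI)
  fix x assume "x \<in> newton_map f ` closure A"
  then obtain z where z: "z \<in> closure A" "x = newton_map f z" by blast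
  define w where "w = g z"
  have w: "Re w \<le> M" "\<psi> w = z" "z \<in> S"
    using closure_A[OF z(1)] S_E(2) by (auto simp: w_def)
  \<comment> \<open>\<open>Re_step\<close> does not reach the line \<open>Re w = M\<close>, but
    \<open>h_move\<close> holds up to \<open>L - T / 2\<close>, beyond that line. A deviation of at
    most 1/2 still leaves a step to the left.\<close>
  then have "norm (h w - w + 1) \<le> \<kappa> / 4 / (L - Re w)" using M_far by (intro h_move) simp
  also have "\<dots> \<le> \<kappa> / 4 / T"
    using w \<kappa>_facts T_ge by (intro divide_left_mono mult_pos_pos) (auto simp: M_def)
  also have "\<dots> \<le> 1/2" using \<kappa>_facts by (auto simp: T_def divide_simps)
  finally have "Re (h w) < M"
    using w complex_Re_le_cmod[of "h w - w + 1"] by simp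
  moreover have "\<nu> z = \<psi> (h w)" using \<psi>_h[of w] w M_far by simp
  ultimately show "x \<in> Some ` A" using newton_map_S[OF w(3)] z by (auto simp: A_def)
qed

text \<open>Along the orbit \<open>norm (f z)\<close> is the exponential of a real part tending to
  minus infinity. On the compact part of \<open>closure A\<close> in a disc, \<open>f\<close> has no
  zeros and is bounded away from 0, so the orbit eventually leaves that disc.\<close>

lemma A_tends:
  assumes "z \<in> A"
  shows "iterates_tend_to_infinity (newton_map f) z"
proof -
  obtain w where w: "Re w < M" "z = \<psi> w" using assms by (auto simp: A_def)
  have "\<forall>\<^sub>F n in sequentially. b \<le> norm (\<psi> ((h ^^ n) w))" for b
  proof -
    let ?K = "closure A \<inter> cball 0 b"
    have "compact ?K" by (simp add: closed_Int_compact)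
    then have "compact (f ` ?K)"
      by (intro compact_continuous_image holomorphic_on_imp_continuous_on holomorphic_on_subset[OF f_hol]) auto
    moreover have "0 \<notin> f ` ?K" using f_S(1) closure_A(1) by force
    ultimately obtain e where e: "e > 0" "\<And>y. y \<in> f ` ?K \<Longrightarrow> e \<le> dist 0 y"
      using separate_point_closed[OF compact_imp_closed] by metis
    have "\<forall>\<^sub>F n in sequentially. 2 * (Re w - ln e) < real n"
      using filterlim_real_sequentially unfolding filterlim_at_top_dense by blast
    then show ?thesis
    proof eventually_elim
      case (elim n)
      let ?w = "(h ^^ n) w"
      show ?case
      proof (rule ccontr)
        assume "\<not> b \<le> norm (\<psi> ?w)"
        moreover have "\<psi> ?w \<in> A" using iter_in[OF w(1)] by (auto simp: A_def)
        ultimately have "\<psi> ?w \<in> ?K" using closure_subset[of A] by auto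
        then have "e \<le> exp (Re ?w)" using e(2)[OF imageI, of "\<psi> ?w"] f_\<psi>[of ?w] iter_in[OF w(1), of n] M_less by auto
        then have "ln e \<le> Re ?w" using e(1) by (metis exp_gt_zero ln_exp ln_le_cancel_iff)
        moreover have "Re ?w \<le> Re w - n / 2" by (rule Re_iter[OF w(1)])
        moreover have "Re w - n / 2 < ln e" using elim by (simp add: field_simps)
        ultimately show False by linarith
      qed
    qed
  qed
  then show ?thesis
    using w iterate_A by (simp add: iterates_tend_to_infinity_def filterlim_at_infinity[of 0])
qed

lemma unit_iterate: "iterate unit_translation n z = Some (z + of_nat n)"
  by (induction n) (auto simp: unit_translation_def)

lemma conformal_conjugacy_plane: "\<exists>\<Phi>. conformal_conjugacy (newton_map f) seed.V UNIV \<Phi>"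
proof -
  let ?P = "{w. Re w < M}"
  obtain \<phi> where \<phi>: "\<phi> holomorphic_on ?P" "\<And>w. Re w < M \<Longrightarrow> \<phi> (h w) = \<phi> w + 1"
    "\<And>w w'. \<lbrakk>Re w < M; Re w' < M\<rbrakk> \<Longrightarrow> norm (\<phi> w - \<phi> w' + (w - w')) \<le> norm (w - w') / 2"
    using fatou_coordinate by blast
  have expand: "1/2 * dist w w' \<le> dist (\<phi> w) (\<phi> w')" if "w \<in> ?P" "w' \<in> ?P" for w w'
    using \<phi>(3)[of w w'] that norm_triangle_ineq4[of "\<phi> w - \<phi> w' + (w - w')" "\<phi> w - \<phi> w'"]
    by (simp add: dist_norm)
  have \<phi>_inj: "inj_on \<phi> ?P"
  proof (rule inj_onI)
    fix x y assume "x \<in> ?P" "y \<in> ?P" "\<phi> x = \<phi> y"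
    then show "x = y" using expand[of x y] by simp
  qed
  have "(\<phi> \<circ> g) holomorphic_on A"
    by (rule holomorphic_on_compose_gen[OF holomorphic_on_subset[OF g_hol A_sub_S] \<phi>(1)])
       (auto simp: in_A_iff)
  moreover have "(\<phi> \<circ> g) (the (newton_map f z)) = (\<phi> \<circ> g) z + 1" if "z \<in> A" for z
  proof -
    obtain w where w: "Re w < M" "z = \<psi> w" using \<open>z \<in> A\<close> by (auto simp: A_def)
    then show ?thesis using newton_map_A[OF w(1)] \<phi>(2)[OF w(1)] iter_in[OF w(1), of 1] M_less by simp
  qed
  ultimately obtain \<Phi> where \<Phi>: "\<Phi> holomorphic_on seed.V"
    "\<And>z. z \<in> seed.V \<Longrightarrow> \<Phi> (the (newton_map f z)) = \<Phi> z + 1" "\<And>z. z \<in> A \<Longrightarrow> \<Phi> z = (\<phi> \<circ> g) z"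
    using seed.conjugacy_extends by blast
  have im: "\<Phi> ` A = \<phi> ` ?P"
  proof -
    have "\<Phi> ` A = (\<lambda>z. \<phi> (g z)) ` A" using \<Phi>(3) by auto
    also have "\<dots> = \<phi> ` ?P" using M_less by (force simp: A_def image_image)
    finally show ?thesis .
  qed
  have "inj_on \<Phi> A"
  proof (rule inj_onI)
    fix x y assume xy: "x \<in> A" "y \<in> A" "\<Phi> x = \<Phi> y"
    then have "g x = g y" using \<phi>_inj \<Phi>(3) by (auto simp: in_A_iff dest: inj_onD)
    then show "x = y" using xy S_E(2) in_A_iff by metis
  qed
  moreover have "weakly_absorbing unit_translation UNIV (\<Phi> ` A)"
    unfolding weakly_absorbing_def im
  proof (intro conjI allI impI)
    show "complex_domain UNIV" "invariant_under unit_translation UNIV"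
      by (auto simp: complex_domain_def invariant_under_def unit_translation_def)
    show "open (\<phi> ` ?P)" by (rule open_mapping_thm3[OF \<phi>(1) open_halfspace_Re_lt \<phi>_inj])
    show "connected (\<phi> ` ?P)"
      by (intro connected_continuous_image holomorphic_on_imp_continuous_on \<phi>(1)
          convex_connected convex_halfspace_Re_lt)
    show "simply_connected (\<phi> ` ?P)"
      by (intro simply_connected_injective_holomorphic_image open_halfspace_Re_lt \<phi>(1) \<phi>_inj
          convex_imp_simply_connected convex_halfspace_Re_lt)
    show "invariant_under unit_translation (\<phi> ` ?P)"
      unfolding invariant_under_def unit_translation_def
    proof clarify
      fix w assume "Re w < M"
      then have "\<phi> w + 1 = \<phi> (h w)" "Re (h w) < M" using \<phi>(2) iter_in[of w 1] by auto
      then show "Some (\<phi> w + 1) \<in> Some ` \<phi> ` ?P" by auto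
    qed
    fix K :: "complex set" assume "compact K \<and> K \<subseteq> UNIV"
    then obtain b where b: "\<And>z. z \<in> K \<Longrightarrow> norm z \<le> b"
      using compact_imp_bounded[of K] unfolding bounded_iff by blast
    \<comment> \<open>After \<open>n\<close> steps from \<open>w0\<close> a disc of radius
      \<open>n / 2\<close> fits into the half-plane. As \<open>\<phi>\<close> shrinks distances at
      most by the factor 1/2, its image contains the disc of radius \<open>n / 4\<close> about
      \<open>\<phi> w0 + n\<close>, and for this \<open>n\<close> that disc contains the translate
      of \<open>K\<close> by \<open>n\<close>.\<close>
    obtain n :: nat where n: "4 * (b + norm (\<phi> w0)) < real n" "0 < n"
      using reals_Archimedean2[of "max 0 (4 * (b + norm (\<phi> w0)))"] by auto
    let ?w = "(h ^^ n) w0"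
    have \<phi>n: "\<phi> ((h ^^ m) w0) = \<phi> w0 + of_nat m" for m
      by (induction m) (use \<phi>(2) iter_in[OF Re_w0(1)] in auto)
    have sub: "cball ?w (real n / 2) \<subseteq> ?P"
    proof
      fix x assume "x \<in> cball ?w (real n / 2)"
      then show "x \<in> ?P"
        using complex_Re_le_cmod[of "x - ?w"] Re_iter[OF Re_w0(1), of n] Re_w0
        by (simp add: dist_norm norm_minus_commute)
    qed
    have "ball (\<phi> ?w) (1/2 * (real n / 2)) \<subseteq> \<phi> ` cball ?w (real n / 2)"
      by (rule ball_subset_image_expanding[OF open_halfspace_Re_lt \<phi>(1) sub])
         (use expand n in auto)
    moreover have "z + of_nat n \<in> ball (\<phi> ?w) (1/2 * (real n / 2))" if "z \<in> K" for z
    proof -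
      have "norm (\<phi> w0 - z) \<le> b + norm (\<phi> w0)"
        using b[OF that] norm_triangle_ineq4[of "\<phi> w0" z] by linarith
      then show ?thesis using n by (simp add: \<phi>n dist_norm)
    qed
    moreover have "\<phi> ` cball ?w (real n / 2) \<subseteq> \<phi> ` ?P" using sub by blast
    ultimately have "z + of_nat n \<in> \<phi> ` ?P" if "z \<in> K" for z
      using that by blast
    then show "\<exists>k. iterate unit_translation k ` K \<subseteq> Some ` \<phi> ` ?P"
      by (intro exI[of _ n]) (auto simp: unit_iterate)
  qed simp
  moreover have "map_option \<Phi> (newton_map f z) = unit_translation (\<Phi> z)" if "z \<in> seed.V" for z
    using \<Phi>(2)[OF that] seed.V_inv that by (force simp: invariant_under_def unit_translation_def)
  ultimately show ?thesis
    unfolding conformal_conjugacy_def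
    using \<Phi>(1) seed.V_weakly_absorbing
    by (intro exI[of _ \<Phi>]) (auto simp: complex_domain_def invariant_under_def unit_translation_def)
qed

end

section \<open>Self-maps of the disc and Riemann maps\<close>

definition riemann_pair ::
    "complex set \<Rightarrow> complex \<Rightarrow> (complex \<Rightarrow> complex) \<Rightarrow> (complex \<Rightarrow> complex) \<Rightarrow> bool" where
  "riemann_pair B z p q \<longleftrightarrow>
     p holomorphic_on ball 0 1 \<and> q holomorphic_on B \<and> p ` ball 0 1 \<subseteq> B \<and> q ` B \<subseteq> ball 0 1 \<and>
     p 0 = z \<and> (\<forall>u\<in>ball 0 1. q (p u) = u) \<and> (\<forall>x\<in>B. p (q x) = x)"

lemma riemann_pairD:
  assumes "riemann_pair B z p q"
  shows "p holomorphic_on ball 0 1" "q holomorphic_on B" "p ` ball 0 1 \<subseteq> B" "q ` B \<subseteq> ball 0 1"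
    "\<And>u. u \<in> ball 0 1 \<Longrightarrow> q (p u) = u" "\<And>x. x \<in> B \<Longrightarrow> p (q x) = x"
    "p 0 = z" "q z = 0" "inj_on p (ball 0 1)"
proof -
  show *: "p holomorphic_on ball 0 1" "q holomorphic_on B" "p ` ball 0 1 \<subseteq> B" "q ` B \<subseteq> ball 0 1"
    "\<And>u. u \<in> ball 0 1 \<Longrightarrow> q (p u) = u" "\<And>x. x \<in> B \<Longrightarrow> p (q x) = x" "p 0 = z"
    using assms by (auto simp: riemann_pair_def)
  show "q z = 0" using *(5)[of 0] *(7) by simp
  show "inj_on p (ball 0 1)" using *(5) by (rule inj_on_inverseI)
qed

lemma riemann_pair_exists:
  assumes B: "open B" "simply_connected B" "B \<noteq> UNIV" and z: "z \<in> B"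
  shows "\<exists>p q. riemann_pair B z p q"
proof -
  obtain f g where fg: "f holomorphic_on B" "g holomorphic_on ball 0 1"
    "\<And>x. x \<in> B \<Longrightarrow> f x \<in> ball 0 1 \<and> g (f x) = x" "\<And>u. u \<in> ball 0 1 \<Longrightarrow> g u \<in> B \<and> f (g u) = u"
    using Riemann_mapping_theorem[of B] B z by blast
  obtain k l where kl: "k (f z) = 0" "k holomorphic_on ball 0 1" "k ` ball 0 1 \<subseteq> ball 0 1"
    "l holomorphic_on ball 0 1" "l ` ball 0 1 \<subseteq> ball 0 1"
    "\<And>z. z \<in> ball 0 1 \<Longrightarrow> k (l z) = z" "\<And>z. z \<in> ball 0 1 \<Longrightarrow> l (k z) = z"
    using ball_biholomorphism_exists[of "f z"] fg(3)[OF z] by metis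
  have l0: "l 0 = f z" using kl(1) kl(7)[of "f z"] fg(3)[OF z] by simp
  have "riemann_pair B z (g \<circ> l) (k \<circ> f)"
    unfolding riemann_pair_def
  proof (intro conjI ballI)
    show "(g \<circ> l) holomorphic_on ball 0 1" by (rule holomorphic_on_compose_gen[OF kl(4) fg(2) kl(5)])
    show "(k \<circ> f) holomorphic_on B" by (rule holomorphic_on_compose_gen[OF fg(1) kl(2)]) (use fg(3) in blast)
    show "(g \<circ> l) ` ball 0 1 \<subseteq> B" using fg(4) kl(5) by fastforce
    show "(k \<circ> f) ` B \<subseteq> ball 0 1" using fg(3) kl(3) by fastforce
    show "(g \<circ> l) 0 = z" using l0 fg(3)[OF z] by simp
    show "(k \<circ> f) ((g \<circ> l) u) = u" if "u \<in> ball 0 1" for u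
      using fg(4)[of "l u"] kl(5,6) that by (metis comp_apply image_subset_iff)
    show "(g \<circ> l) ((k \<circ> f) x) = x" if "x \<in> B" for x
      using fg(3)[OF that] kl(7) by (metis comp_apply)
  qed
  then show ?thesis by blast
qed

lemma deriv_compose_inverse:
  assumes "f holomorphic_on X" "open X" "g holomorphic_on Y" "open Y" "x \<in> X" "f ` X \<subseteq> Y"
    and inv: "\<And>x. x \<in> X \<Longrightarrow> g (f x) = x"
  shows "deriv g (f x) * deriv f x = 1"
proof -
  have fx: "f x \<in> Y" using assms by blast
  have "(g \<circ> f has_field_derivative deriv g (f x) * deriv f x) (at x)"
    by (intro DERIV_chain holomorphic_derivI[OF assms(3,4) fx] holomorphic_derivI[OF assms(1,2,5)])
  moreover have "(g \<circ> f has_field_derivative 1) (at x)"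
    by (rule DERIV_cong_ev[THEN iffD1, OF refl _ refl DERIV_ident])
       (use assms in \<open>auto simp: eventually_nhds\<close>)
  ultimately show ?thesis by (rule DERIV_unique)
qed

text \<open>The growth theorem at radius 1/2 and Cauchy's inequality on discs of radius 1/4 bound
  the second derivative, with 32 arising as \<open>fact 2 * 4 ^ 2\<close>; the mean value inequality
  does the rest.\<close>

lemma univalent_deriv_bound:
  assumes p: "p holomorphic_on ball 0 1" "inj_on p (ball 0 1)" and u: "norm u \<le> 1/4"
  shows "norm (deriv p u) \<le> (1 + 32 * growth_bound (1/2) * norm u) * norm (deriv p 0)"
proof -
  let ?B = "32 * growth_bound (1/2) * norm (deriv p 0)"
  have d2: "norm (deriv (deriv p) x) \<le> ?B" if x: "x \<in> cball 0 (1/4)" for x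
  proof -
    have sub: "norm y \<le> 1/2" if "y \<in> ball x (1/4)" for y
      using that x norm_triangle_ineq[of "y - x" x] by (simp add: dist_norm norm_minus_commute)
    have "norm ((deriv ^^ 2) p x) \<le> fact 2 * (growth_bound (1/2) * norm (deriv p 0)) / (1/4) ^ 2"
    proof (rule Cauchy_inequality_ball)
      show "p holomorphic_on ball x (1/4)"
        by (rule holomorphic_on_subset[OF p(1)]) (use sub in force)
      show "norm (p y - p 0) \<le> growth_bound (1/2) * norm (deriv p 0)" if "y \<in> ball x (1/4)" for y
        using koebe_growth[OF p, of "1/2" y] sub[OF that] by (simp add: dist_norm norm_minus_commute)
    qed auto
    then show ?thesis by (simp add: numeral_2_eq_2 power_divide)
  qed
  have "norm (deriv p u - deriv p 0) \<le> ?B * norm (u - 0)"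
  proof (rule field_differentiable_bound[of "cball 0 (1/4)"])
    show "(deriv p has_field_derivative deriv (deriv p) x) (at x within cball 0 (1/4))" if "x \<in> cball 0 (1/4)" for x
      using that holomorphic_derivI[OF holomorphic_deriv[OF p(1) open_ball] open_ball, of x]
      by (auto intro: has_field_derivative_at_within)
  qed (use d2 u in auto)
  then show ?thesis using norm_triangle_sub[of "deriv p u" "deriv p 0"] by (simp add: algebra_simps)
qed

lemma disc_map_deriv_le_1:
  assumes "G holomorphic_on ball 0 1" "G ` ball 0 1 \<subseteq> ball 0 1"
  shows "norm (deriv G 0) \<le> 1"
proof -
  have "norm ((deriv ^^ 1) G 0) \<le> fact 1 * 1 / 1 ^ 1"
    by (rule Cauchy_inequality_ball[where b = 0]) (use assms in \<open>auto simp: image_subset_iff less_imp_le\<close>)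
  then show ?thesis by simp
qed

text \<open>By the chain rule the modulus of the derivative is \<open>norm (deriv k z)\<close> times
  the ratio of the conformal radii of \<open>B\<close> at \<open>z\<close> and at
  \<open>k z\<close>. The point \<open>k z\<close> has small coordinate \<open>\<zeta>\<close> in
  the Riemann map at \<open>z\<close>, so the radius at \<open>k z\<close> exceeds that at
  \<open>z\<close> by a factor of at most
  \<open>1 + 32 * growth_bound (1/2) * \<eta>\<close>.\<close>

lemma renormalized_deriv_ge:
  assumes B: "open B" and k: "k holomorphic_on B" "k ` B \<subseteq> B"
    and pq: "riemann_pair B z p q" and pq': "riemann_pair B (k z) p' q'"
    and d: "ball z d \<subseteq> B" "0 < d" and \<eta>: "dist z (k z) \<le> \<eta> * d" "0 < \<eta>" "\<eta> \<le> 1/4"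
    and dk: "1 - \<eta> \<le> norm (deriv k z)"
  shows "(1 - \<eta>) / (1 + 32 * growth_bound (1/2) * \<eta>) \<le> norm (deriv (q' \<circ> k \<circ> p) 0)"
proof -
  let ?z = z and ?z' = "k z" and ?C = "32 * growth_bound (1/2)"
  note p = riemann_pairD[OF pq] and p' = riemann_pairD[OF pq']
  have z: "z \<in> B" "k z \<in> B" using imageI[of 0 "ball 0 1" p] imageI[of 0 "ball 0 1" p'] p(3,7) p'(3,7) by auto
  define \<zeta> where "\<zeta> = q ?z'"
  have dd: "dist ?z ?z' < d" using \<eta> d(2) mult_right_mono[of \<eta> "1/4" d] by linarith
  have "dist (q ?z) (q ?z') \<le> 1 * dist ?z ?z' / d"
    by (rule Schwarz_ball[OF holomorphic_on_subset[OF p(2) d(1)] _ dd]) (use p(4,8) d(1) in auto)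
  also have "\<dots> \<le> \<eta>" using \<eta> d(2) by (simp add: divide_simps)
  finally have \<zeta>: "norm \<zeta> \<le> \<eta>" by (simp add: p(8) \<zeta>_def)
  have \<zeta>in: "\<zeta> \<in> ball 0 1" using \<zeta> \<eta> by simp
  have p\<zeta>: "p \<zeta> = ?z'" using p(6)[OF z(2)] by (simp add: \<zeta>_def)
  have "norm (deriv p \<zeta>) \<le> (1 + ?C * norm \<zeta>) * norm (deriv p 0)"
    using \<zeta> \<eta> by (intro univalent_deriv_bound p(1,9)) auto
  also have "\<dots> \<le> (1 + ?C * \<eta>) * norm (deriv p 0)"
    using \<zeta> growth_bound_pos[of "1/2"] by (intro mult_right_mono add_left_mono mult_left_mono) auto
  finally have pp: "norm (deriv p \<zeta>) \<le> (1 + ?C * \<eta>) * norm (deriv p 0)" .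
  have 1: "deriv q ?z' * deriv p \<zeta> = 1"
    using deriv_compose_inverse[OF p(1) open_ball p(2) B \<zeta>in p(3) p(5)] p\<zeta> by simp
  have 2: "deriv q' ?z' * deriv p' 0 = 1"
    using deriv_compose_inverse[OF p'(1) open_ball p'(2) B _ p'(3) p'(5), of 0] p'(7) by simp
  \<comment> \<open>The change of Riemann coordinates \<open>q \<circ> p'\<close> maps the disc into
    itself, so its derivative at 0 has modulus at most 1. This compares \<open>deriv p' 0\<close>
    with \<open>deriv p \<zeta>\<close>.\<close>
  have "deriv (q \<circ> p') 0 = deriv q (p' 0) * deriv p' 0"
    by (rule deriv_chain) (use p(2) p'(1) B z p'(7) in \<open>auto intro: holomorphic_on_imp_differentiable_at\<close>)
  moreover have "norm (deriv (q \<circ> p') 0) \<le> 1"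
    by (rule disc_map_deriv_le_1[OF holomorphic_on_compose_gen[OF p'(1) p(2) p'(3)]]) (use p(4) p'(3) in fastforce)
  ultimately have 3: "norm (deriv q ?z') * norm (deriv p' 0) \<le> 1" using p'(7) by (simp add: norm_mult)
  have n1: "norm (deriv q ?z') * norm (deriv p \<zeta>) = 1" "norm (deriv q' ?z') * norm (deriv p' 0) = 1"
    using arg_cong[OF 1, of norm] arg_cong[OF 2, of norm] by (simp_all add: norm_mult)
  then have pos: "0 < norm (deriv q ?z')" "0 < norm (deriv p' 0)"
    by (auto simp: zero_less_norm_iff)
  have "norm (deriv q ?z') * norm (deriv p' 0) \<le> norm (deriv q ?z') * norm (deriv p \<zeta>)" using 3 n1 by simp
  then have "norm (deriv p' 0) \<le> norm (deriv p \<zeta>)" using pos by simp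
  with pp have le: "norm (deriv p' 0) \<le> (1 + ?C * \<eta>) * norm (deriv p 0)" by linarith
  have fd: "p field_differentiable at 0" "(q' \<circ> k) field_differentiable at z"
    using holomorphic_on_imp_differentiable_at[OF p(1) open_ball]
      holomorphic_on_imp_differentiable_at[OF holomorphic_on_compose_gen[OF k(1) p'(2) k(2)] B z(1)]
    by auto
  have "deriv (q' \<circ> k \<circ> p) 0 = deriv (q' \<circ> k) z * deriv p 0"
    unfolding p(7)[symmetric]
    by (rule deriv_chain) (use fd p(7) in auto)
  also have "deriv (q' \<circ> k) z = deriv q' ?z' * deriv k ?z"
    by (rule deriv_chain) (use p'(2) k B z in \<open>auto intro: holomorphic_on_imp_differentiable_at\<close>)
  finally have "norm (deriv (q' \<circ> k \<circ> p) 0) = norm (deriv q' ?z') * norm (deriv k ?z) * norm (deriv p 0)"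
    by (simp only: norm_mult)
  also have "norm (deriv q' ?z') = 1 / norm (deriv p' 0)"
    using n1(2) pos by (simp add: divide_simps)
  finally have "norm (deriv (q' \<circ> k \<circ> p) 0) = norm (deriv k ?z) * norm (deriv p 0) / norm (deriv p' 0)"
    by (simp only: times_divide_eq_left mult_1_left)
  moreover have "(1 - \<eta>) / (1 + ?C * \<eta>) \<le> norm (deriv k ?z) * norm (deriv p 0) / norm (deriv p' 0)"
  proof -
    have c: "0 < 1 + ?C * \<eta>" using growth_bound_pos[of "1/2"] \<eta> by (intro add_pos_pos mult_pos_pos) auto
    have "(1 - \<eta>) * norm (deriv p' 0) \<le> (1 - \<eta>) * ((1 + ?C * \<eta>) * norm (deriv p 0))"
      using le \<eta> by (intro mult_left_mono) auto
    also have "\<dots> \<le> norm (deriv k ?z) * ((1 + ?C * \<eta>) * norm (deriv p 0))"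
      using dk c by (intro mult_right_mono) auto
    finally show ?thesis using c pos by (simp add: divide_simps mult_ac)
  qed
  ultimately show ?thesis by simp
qed

text \<open>Schwarz's lemma writes \<open>G z\<close> as \<open>z * g z\<close> with
  \<open>g\<close> bounded by 1. Since \<open>g 0\<close> nearly attains this bound,
  \<open>g\<close> can vary only little, which Harnack's inequality makes quantitative.\<close>

lemma near_rotation_bound:
  assumes G: "G holomorphic_on ball 0 1" "G 0 = 0" "G ` ball 0 1 \<subseteq> ball 0 1"
    and \<epsilon>: "0 < \<epsilon>" "1 - \<epsilon> \<le> norm (deriv G 0)" and z: "norm z < 1"
  shows "norm (G z - deriv G 0 * z) \<le> 4 * \<epsilon> / (1 - norm z)"
proof -
  obtain g where g: "g holomorphic_on ball 0 1" "\<And>z. norm z < 1 \<Longrightarrow> G z = z * g z" "deriv G 0 = g 0"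
    using Schwarz3[OF G(1,2)] by blast
  have g1: "norm (g x) \<le> 1" if "norm x < 1" for x
  proof (cases "x = 0")
    case True
    then show ?thesis using disc_map_deriv_le_1[OF G(1,3)] g(3) by simp
  next
    case False
    have "norm (G x) \<le> norm x" using Schwarz_Lemma(1)[OF G(1,2) _ that] G(3) by (simp add: image_subset_iff)
    then show ?thesis using False g(2)[OF that] by (simp add: norm_mult)
  qed
  define a where "a = g 0"
  have na: "norm a \<le> 1" "1 - \<epsilon> \<le> norm a" using g1[of 0] \<epsilon> g(3) by (auto simp: a_def)
  \<comment> \<open>The rotation taking \<open>a\<close> to \<open>norm a\<close>; for
    \<open>a = 0\<close> any unimodular number serves.\<close>
  define \<alpha> where "\<alpha> = (if a = 0 then 1 else cnj a / of_real (norm a))"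
  have \<alpha>: "norm \<alpha> = 1" "\<alpha> * a = of_real (norm a)"
    using complex_norm_square[of a]
    by (auto simp: \<alpha>_def norm_divide power2_eq_square mult.commute[of "cnj a"] divide_simps)
  \<comment> \<open>Harnack's inequality for \<open>Q\<close>, which has positive real part also when \<open>G\<close> is a rotation.\<close>
  define e where "e = 1 + \<epsilon> - norm a"
  have e: "0 < e" "e \<le> 2 * \<epsilon>" using na \<epsilon> by (auto simp: e_def)
  define Q where "Q = (\<lambda>x. of_real (1 + \<epsilon>) - \<alpha> * g x)"
  have Q0: "Q 0 = of_real e" by (simp add: Q_def e_def \<alpha> flip: a_def)
  have ReQ: "0 < Re (Q x)" if "norm x < 1" for x
  proof -
    have "Re (\<alpha> * g x) \<le> 1"
      using complex_Re_le_cmod[of "\<alpha> * g x"] g1[OF that] \<alpha> by (simp add: norm_mult)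
    then show ?thesis using \<epsilon> by (simp add: Q_def)
  qed
  \<comment> \<open>The Cayley transform of \<open>Q\<close>, vanishing at 0 because
    \<open>Q 0\<close> is \<open>e\<close>. Schwarz's lemma for \<open>m\<close> is the required
    form of Harnack's inequality.\<close>
  define m where "m = (\<lambda>x. (Q x - of_real e) / (Q x + of_real e))"
  have nz: "Q x + of_real e \<noteq> 0" if "norm x < 1" for x
    using ReQ[OF that] e by (metis add_pos_pos Re_complex_of_real less_irrefl plus_complex.sel(1) zero_complex.sel(1))
  have "norm (m z) \<le> norm z"
  proof (rule Schwarz_Lemma(1)[OF _ _ _ z])
    show "m holomorphic_on ball 0 1" unfolding m_def Q_def
      by (intro holomorphic_intros g) (use nz in \<open>auto simp: Q_def\<close>)
    show "m 0 = 0" by (simp add: m_def Q0)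
    fix x :: complex assume x: "norm x < 1"
    have "norm (Q x - of_real e) ^ 2 < norm (Q x + of_real e) ^ 2"
      using mult_pos_pos[OF ReQ[OF x] e(1)] unfolding cmod_power2 by (simp add: power2_eq_square algebra_simps)
    then have "norm (Q x - of_real e) < norm (Q x + of_real e)" by (simp add: power_less_imp_less_base)
    then show "norm (m x) < 1" using nz[OF x] by (simp add: m_def norm_divide)
  qed
  then have "norm (Q z - of_real e) \<le> norm z * norm (Q z + of_real e)"
    using nz[OF z] by (simp add: m_def norm_divide divide_simps)
  also have "\<dots> \<le> norm z * (norm (Q z - of_real e) + 2 * e)"
    using norm_triangle_ineq[of "Q z - of_real e" "of_real (2 * e)"] e by (intro mult_left_mono) (auto simp: norm_mult add.commute)
  finally have "norm (Q z - of_real e) * (1 - norm z) \<le> 2 * e * norm z" by (simp add: algebra_simps)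
  also have "\<dots> \<le> 4 * \<epsilon> * 1" using mult_mono[of "2 * e" "4 * \<epsilon>" "norm z" 1] e z by simp
  finally have "norm (Q z - of_real e) \<le> 4 * \<epsilon> / (1 - norm z)" using z by (simp add: divide_simps)
  moreover have "Q z - of_real e = - \<alpha> * (g z - a)"
    using \<alpha>(2) by (simp add: Q_def e_def algebra_simps)
  then have "norm (Q z - of_real e) = norm (g z - a)" using \<alpha> by (simp add: norm_mult)
  moreover have "norm (G z - deriv G 0 * z) \<le> norm (g z - a)"
    using g(2)[OF z] g(3) z mult_right_mono[of "norm z" 1 "norm (g z - a)"]
    by (simp add: a_def norm_mult flip: right_diff_distrib mult.commute[of z])
  ultimately show ?thesis by simp
qed

lemma near_rotation_injective:
  assumes \<rho>: "0 < \<rho>" "\<rho> < 1"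
  obtains \<epsilon> where "0 < \<epsilon>" "\<And>G. \<lbrakk>G holomorphic_on ball 0 1; G 0 = 0; G ` ball 0 1 \<subseteq> ball 0 1;
      1 - \<epsilon> \<le> norm (deriv G 0)\<rbrakk> \<Longrightarrow> inj_on G (ball 0 \<rho>)"
proof -
  \<comment> \<open>Discs of radius \<open>s\<close> about points of \<open>ball 0 \<rho>\<close>
    stay in \<open>norm z < 1 - s\<close>, where the error \<open>E\<close> is at most
    \<open>4 * \<epsilon> / s\<close>. Cauchy's inequality then bounds \<open>deriv E\<close> by
    \<open>4 * \<epsilon> / s\<^sup>2\<close>, that is by 1/4, while the linear part has modulus
    above 1/2.\<close>
  define s where "s = (1 - \<rho>) / 2"
  have s: "0 < s" "s < 1" using \<rho> by (auto simp: s_def)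
  define \<epsilon> where "\<epsilon> = s\<^sup>2 / 16"
  have \<epsilon>: "0 < \<epsilon>" "\<epsilon> < 1/4" using s power_le_one[of s 2] by (auto simp: \<epsilon>_def)
  show ?thesis
  proof
    fix G assume G: "G holomorphic_on ball 0 1" "G 0 = 0" "G ` ball 0 1 \<subseteq> ball 0 1" "1 - \<epsilon> \<le> norm (deriv G 0)"
    let ?a = "deriv G 0"
    define E where "E = (\<lambda>z. G z - ?a * z)"
    have E: "E holomorphic_on ball 0 1" unfolding E_def by (intro holomorphic_intros G)
    have dE: "norm (deriv E x) \<le> 1/2" if x: "x \<in> ball 0 \<rho>" for x
    proof -
      have sub: "norm y < 1 - s" if "y \<in> ball x s" for y
        using that x norm_triangle_ineq[of "y - x" x] by (simp add: dist_norm norm_minus_commute s_def field_simps)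
      have "norm ((deriv ^^ 1) E x) \<le> fact 1 * (4 * \<epsilon> / s) / s ^ 1"
      proof (rule Cauchy_inequality_ball[where b = 0])
        show "E holomorphic_on ball x s" by (rule holomorphic_on_subset[OF E]) (use sub s in force)
        fix y assume y: "y \<in> ball x s"
        have "norm (E y) \<le> 4 * \<epsilon> / (1 - norm y)"
          unfolding E_def using sub[OF y] s \<epsilon> G by (intro near_rotation_bound) auto
        also have "\<dots> \<le> 4 * \<epsilon> / s" using sub[OF y] s \<epsilon> by (intro divide_left_mono mult_pos_pos) auto
        finally show "norm (E y - 0) \<le> 4 * \<epsilon> / s" by simp
      qed (use s in auto)
      also have "fact 1 * (4 * \<epsilon> / s) / s ^ 1 = (1/4::real)" using s by (simp add: \<epsilon>_def power2_eq_square)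
      finally show ?thesis by simp
    qed
    show "inj_on G (ball 0 \<rho>)"
    proof (rule inj_onI)
      fix x y assume xy: "x \<in> ball 0 \<rho>" "y \<in> ball 0 \<rho>" "G x = G y"
      have "norm (E x - E y) \<le> 1/2 * norm (x - y)"
      proof (rule field_differentiable_bound[OF convex_ball, of 0 \<rho>])
        show "(E has_field_derivative deriv E x) (at x within ball 0 \<rho>)" if "x \<in> ball 0 \<rho>" for x
          using holomorphic_derivI[OF E open_ball, of x] that \<rho> by (auto intro: has_field_derivative_at_within)
      qed (use dE xy in auto)
      moreover have "E x - E y = - ?a * (x - y)" using xy(3) by (simp add: E_def algebra_simps)
      ultimately have "norm ?a * norm (x - y) \<le> 1/2 * norm (x - y)" by (simp add: norm_mult)
      moreover have "norm ?a > 1/2" using G(4) \<epsilon> by linarith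
      then have "0 < norm (x - y) \<Longrightarrow> 1/2 * norm (x - y) < norm ?a * norm (x - y)"
        by (rule mult_strict_right_mono)
      ultimately show "x = y" by (metis eq_iff_diff_eq_0 leD zero_less_norm_iff)
    qed
  qed (rule \<epsilon>(1))
qed

section \<open>Maximality\<close>

context log_tract
begin

text \<open>The reference orbit in both coordinates, with \<open>dn n\<close> the length of its
  \<open>n\<close>-th Newton step (see \<open>dist_zn\<close>), the natural unit of length near
  \<open>zn n\<close>.\<close>

definition wn :: "nat \<Rightarrow> complex" where "wn n = (h ^^ n) w0"
definition zn :: "nat \<Rightarrow> complex" where "zn n = \<psi> (wn n)"
definition dn :: "nat \<Rightarrow> real" where "dn n = norm (deriv \<psi> (wn n))"

lemma Re_wn: "Re (wn n) \<le> M - 1 - n / 2" "Re (wn n) < M" "Re (wn n) < L"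
  using Re_iter[OF Re_w0(1), of n] Re_w0 iter_in[OF Re_w0(1), of n] M_less by (auto simp: wn_def)

lemma R_wn: "real n / 2 \<le> L - Re (wn n)"
  using Re_wn(1)[of n] M_less by linarith

lemma dn_pos: "0 < dn n"
  using deriv_\<psi>_nz[OF Re_wn(3)] by (simp add: dn_def)

lemma zn_in_A: "zn n \<in> A"
  using Re_wn(2) by (auto simp: zn_def A_def)

lemma zn_0: "zn 0 = z0"
  by (simp add: zn_def wn_def z0_def)

text \<open>Limit points of \<open>A\<close> lie in the tract, where
  \<open>norm (f z) < exp M\<close> characterises membership in \<open>A\<close>; hence
  \<open>A\<close> is relatively closed as well as open in \<open>X\<close>.\<close>

lemma A_of_component:
  assumes X: "connected X" "X \<inter> A \<noteq> {}" and f: "\<And>x. x \<in> X \<Longrightarrow> norm (f x) < exp M"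
  shows "X \<subseteq> A"
proof -
  have "X \<inter> closure A \<subseteq> A"
  proof
    fix z assume z: "z \<in> X \<inter> closure A"
    then have "z \<in> S" using closure_A by blast
    moreover have "norm (f z) < exp M" using f z by blast
    ultimately show "z \<in> A" using f_S(1)[of z] by (simp add: in_A_iff)
  qed
  then have "X \<inter> A = X \<inter> closure A" using closure_subset by blast
  then have "closedin (top_of_set X) (X \<inter> A)" by (simp add: closedin_closed_Int)
  moreover have "openin (top_of_set X) (X \<inter> A)" by (simp add: openin_open_Int seed.A_open)
  ultimately show ?thesis using X by (metis connected_clopen inf.absorb_iff1)
qed

text \<open>The Koebe radius at \<open>wn n\<close> is \<open>koebe_radius * (L - Re (wn n))\<close>
  step lengths, a number that tends to infinity, so a disc of \<open>C\<close> step lengths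
  eventually fits. By \<open>g_Lipschitz\<close> it has bounded size in the half-plane, while the
  orbit gets arbitrarily deep.\<close>

lemma orbit_disc:
  assumes C: "0 < C"
  shows "\<forall>\<^sub>F n in sequentially. \<forall>z. dist (zn n) z \<le> C * dn n \<longrightarrow>
           z \<in> A \<and> dist (wn n) (g z) \<le> C / koebe_radius"
proof -
  have "\<forall>\<^sub>F n in sequentially. 2 * (C / koebe_radius) < real n"
    using filterlim_real_sequentially unfolding filterlim_at_top_dense by blast
  then show ?thesis
  proof eventually_elim
    case (elim n)
    show ?case
    proof (intro allI impI)
      fix z assume z: "dist (zn n) z \<le> C * dn n"
      have Cn: "C / koebe_radius < real n / 2" using elim by (simp add: field_simps)
      then have "C < koebe_radius * (real n / 2)" using koebe_radius_pos by (simp add: divide_simps mult.commute)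
      also have "\<dots> \<le> koebe_radius * (L - Re (wn n))" using R_wn koebe_radius_pos by (intro mult_left_mono) auto
      finally have "C * dn n < \<delta> (wn n)" using dn_pos by (simp add: \<delta>_def dn_def)
      then have lt: "dist (\<psi> (wn n)) z < \<delta> (wn n)" using z by (simp add: zn_def)
      then have zS: "z \<in> S" using ball_sub_S[OF Re_wn(3), of n] by (auto simp: subset_iff)
      have "dist (wn n) (g z) \<le> dist (zn n) z / (koebe_radius * dn n)"
        using g_Lipschitz[OF Re_wn(3) lt] by (simp add: zn_def dn_def)
      also have "\<dots> \<le> (C * dn n) / (koebe_radius * dn n)"
        using z koebe_radius_pos dn_pos[of n] by (intro divide_right_mono) (auto intro: mult_nonneg_nonneg less_imp_le)
      also have "\<dots> = C / koebe_radius" using dn_pos[of n] by simp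
      finally have d: "dist (wn n) (g z) \<le> C / koebe_radius" .
      moreover have "Re (g z) < M"
      proof -
        have "Re (g z) - Re (wn n) \<le> dist (wn n) (g z)"
          using complex_Re_le_cmod[of "g z - wn n"] by (simp add: dist_norm norm_minus_commute)
        then show ?thesis using d Cn Re_wn(1)[of n] by linarith
      qed
      ultimately show "z \<in> A \<and> dist (wn n) (g z) \<le> C / koebe_radius" using zS by (simp add: in_A_iff)
    qed
  qed
qed

end

section \<open>Compact subsets of a competing basin are absorbed by the tract\<close>

locale larger_basin = log_tract +
  fixes W B :: "complex set"
  assumes tends: "\<And>z. z \<in> W \<Longrightarrow> iterates_tend_to_infinity (newton_map f) z"
    and absorb: "weakly_absorbing (newton_map f) W B"
    and A_sub_W: "A \<subseteq> W"
begin

definition nm :: "complex \<Rightarrow> complex" where "nm z = the (newton_map f z)"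

lemma W_inv: "invariant_under (newton_map f) W" and B_inv: "invariant_under (newton_map f) B"
  and open_W: "open W" and B_sub_W: "B \<subseteq> W" and open_B: "open B" and B_sc: "simply_connected B"
  using absorb by (auto simp: weakly_absorbing_def complex_domain_def)

lemma N_nm: "z \<in> W \<Longrightarrow> newton_map f z = Some (nm z)"
  using W_inv by (force simp: invariant_under_def nm_def)

lemma nm_W: "z \<in> W \<Longrightarrow> nm z \<in> W" and nm_B: "z \<in> B \<Longrightarrow> nm z \<in> B"
  using N_nm W_inv B_inv B_sub_W by (force simp: invariant_under_def)+

lemma nm_hol: "nm holomorphic_on W"
  unfolding nm_def[abs_def] by (rule holomorphic_on_subset[OF seed.N_hol]) (use N_nm in auto)

lemma iterate_nm: "z \<in> W \<Longrightarrow> iterate (newton_map f) n z = Some ((nm ^^ n) z)"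
  by (rule iterate_funpow[OF W_inv N_nm])

lemma nm_iter_W: "z \<in> W \<Longrightarrow> (nm ^^ n) z \<in> W" and nm_iter_B: "z \<in> B \<Longrightarrow> (nm ^^ n) z \<in> B"
  by (induction n) (auto simp: nm_W nm_B)

lemma nm_iter_hol: "(nm ^^ n) holomorphic_on W"
proof (induction n)
  case (Suc n)
  have "nm \<circ> (nm ^^ n) holomorphic_on W"
    by (rule holomorphic_on_compose_gen[OF Suc nm_hol]) (auto simp: nm_iter_W)
  then show ?case by (simp add: o_def)
qed (simp add: id_def)

lemma nm_\<psi>: "Re w < M \<Longrightarrow> nm (\<psi> w) = \<psi> (h w)"
  using newton_map_A by (simp add: nm_def)

lemma nm_iter_\<psi>: "Re w < M \<Longrightarrow> (nm ^^ n) (\<psi> w) = \<psi> ((h ^^ n) w)"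
  by (induction n) (auto simp: nm_\<psi> iter_in)

lemma nm_iter_zn: "(nm ^^ m) (zn n) = zn (m + n)"
  using nm_iter_\<psi>[OF Re_wn(2)] by (simp add: zn_def wn_def funpow_add)

lemma nm_zn: "nm (zn n) = zn (Suc n)"
  using nm_iter_zn[of 1 n] by simp

lemma zn_in_W: "zn n \<in> W" using zn_in_A A_sub_W by blast

lemma dist_zn: "dist (zn n) (zn (Suc n)) = dn n"
proof -
  have "zn (Suc n) = \<nu> (zn n)"
    using \<psi>_h[of "wn n"] Re_wn(2)[of n] M_far by (simp add: zn_def wn_def)
  then show ?thesis using \<nu>_\<psi>[OF Re_wn(3)] by (simp add: zn_def dn_def dist_norm)
qed

text \<open>All orbits tend to infinity, so the entire map \<open>nm\<close> has no points of period
  at most two and is a translation by some \<open>a\<close>. Solving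
  \<open>f + a * deriv f = 0\<close> shows that \<open>f\<close> is an exponential, which each step
  multiplies by \<open>exp (-1)\<close>.\<close>

lemma entire_case:
  assumes U: "B = UNIV" and K: "compact K" "connected K" "z0 \<in> K"
  shows "\<exists>n. (nm ^^ n) ` K \<subseteq> A"
proof -
  have W: "W = UNIV" using U B_sub_W by blast
  have no2: "nm (nm x) \<noteq> x" for x
  proof
    assume x: "nm (nm x) = x"
    have "(nm ^^ (2 * n)) x = x" for n by (induction n) (auto simp: x)
    then have it: "the (iterate (newton_map f) (2 * n) x) = x" for n using iterate_nm[of x] W by simp
    have "filterlim (\<lambda>n. the (iterate (newton_map f) n x)) at_infinity sequentially"
      using tends[of x] W by (simp add: iterates_tend_to_infinity_def)
    then have "filterlim (\<lambda>n. the (iterate (newton_map f) (2 * n) x)) at_infinity sequentially"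
      by (rule filterlim_compose) (rule mult_nat_left_at_top, simp)
    then have "filterlim (\<lambda>n::nat. x) at_infinity sequentially" by (simp only: it)
    then show False
      using not_tendsto_and_filterlim_at_infinity[OF sequentially_bot tendsto_const] by blast
  qed
  obtain a where a: "nm = (\<lambda>x. a + x)"
    using holomorphic_involution_point[of nm] nm_hol W no2 by metis
  \<comment> \<open>The equation is read off on \<open>A\<close>, where \<open>deriv f\<close> has
    no zeros, and extended by the identity theorem.\<close>
  have f_deriv: "f z + a * deriv f z = 0" for z
  proof (rule analytic_continuation_open[of A UNIV "\<lambda>z. f z + a * deriv f z" "\<lambda>_. 0"])
    show "f z + a * deriv f z = 0" if "z \<in> A" for z
    proof -
      have "z \<in> S" using that A_sub_S by blast
      then have "a + z = z - f z / deriv f z" "deriv f z \<noteq> 0"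
        using newton_map_S[of z] f_S(3)[of z] a by (auto simp: nm_def \<nu>_def dest: fun_cong[of _ _ z])
      then have "a = - (f z / deriv f z)" by (simp add: algebra_simps eq_neg_iff_add_eq_0)
      then show ?thesis using \<open>deriv f z \<noteq> 0\<close> by simp
    qed
    show "A \<noteq> {}" using seed.a_in by blast
    show "(\<lambda>z. f z + a * deriv f z) holomorphic_on UNIV"
      by (intro holomorphic_intros f_hol holomorphic_deriv) auto
  qed (use seed.A_open in auto)
  have a0: "a \<noteq> 0"
    using f_deriv[of z0] f_S(1)[of z0] seed.a_in A_sub_S by auto
  have "\<exists>c. \<forall>z. f z * exp (z / a) = c"
  proof (rule has_field_derivative_zero_constant[of UNIV "\<lambda>z. f z * exp (z / a)", simplified])
    fix z
    have "(f has_field_derivative deriv f z) (at z)" using holomorphic_derivI[OF f_hol open_UNIV] by blast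
    then have "((\<lambda>z. f z * exp (z / a)) has_field_derivative (f z + a * deriv f z) * exp (z / a) / a) (at z)"
      using a0 by (auto intro!: derivative_eq_intros simp: field_simps)
    then show "((\<lambda>z. f z * exp (z / a)) has_field_derivative 0) (at z)" by (simp add: f_deriv)
  qed
  then obtain c where c: "\<And>z. f z * exp (z / a) = c" by blast
  have f_eq: "f z = c * exp (- (z / a))" for z
    using c[of z] by (simp add: exp_minus field_simps)
  have it: "(nm ^^ n) z = z + of_nat n * a" for n z
    by (induction n) (auto simp: a algebra_simps)
  have f_it: "f ((nm ^^ n) z) = f z * exp (- of_nat n)" for n z
  proof -
    have "- ((z + of_nat n * a) / a) = - (z / a) + - of_nat n" using a0 by (simp add: add_divide_distrib)
    then show ?thesis by (simp only: it f_eq exp_add mult.assoc)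
  qed
  obtain b where b: "\<And>z. z \<in> K \<Longrightarrow> norm (f z) \<le> b" "b > 0"
    using compact_imp_bounded[OF compact_continuous_image[OF holomorphic_on_imp_continuous_on[OF holomorphic_on_subset[OF f_hol]] K(1)]]
    unfolding bounded_pos by auto
  obtain n :: nat where n: "ln b - M < real n" using reals_Archimedean2 by blast
  \<comment> \<open>A small value of \<open>f\<close> alone does not single out this tract;
    connectedness together with the orbit point \<open>zn n\<close> does.\<close>
  have "(nm ^^ n) ` K \<subseteq> A"
  proof (rule A_of_component)
    have "(nm ^^ n) ` K = (\<lambda>z. z + of_nat n * a) ` K" by (simp add: it)
    then show "connected ((nm ^^ n) ` K)"
      using K(2) by (auto intro!: connected_continuous_image continuous_intros)
    have "(nm ^^ n) z0 = zn n" using nm_iter_zn[of n 0] zn_0 by simp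
    then show "(nm ^^ n) ` K \<inter> A \<noteq> {}" using K(3) zn_in_A by (metis IntI empty_iff image_eqI)
    fix x assume "x \<in> (nm ^^ n) ` K"
    then obtain z where z: "z \<in> K" "x = (nm ^^ n) z" by blast
    have "norm (f x) = norm (f z) * exp (- real n)"
      using f_it[of n z] z by (simp add: norm_mult)
    also have "\<dots> \<le> b * exp (- real n)" using b z by simp
    also have "\<dots> = exp (ln b - real n)" using b by (simp add: exp_diff exp_minus field_simps)
    also have "\<dots> < exp M" using n by simp
    finally show "norm (f x) < exp M" .
  qed
  then show ?thesis by blast
qed

text \<open>The absorbing set \<open>B\<close> swallows one fixed disc about \<open>wn j\<close>,
  carried over by \<open>\<psi>\<close>, after \<open>k\<close> steps. The iterates of
  \<open>h\<close> shrink distances at most by the factor 1/2, so the forward images of this disc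
  keep covering discs of fixed size about \<open>wn n\<close>, and in these the discs of
  \<open>C\<close> step lengths have their \<open>g\<close>-images.\<close>

lemma orbit_disc_in_B:
  assumes C: "0 < C"
  shows "\<forall>\<^sub>F n in sequentially. ball (zn n) (C * dn n) \<subseteq> B"
proof -
  \<comment> \<open>Twice the size found in \<open>orbit_disc\<close>, with a margin that turns the
    closed bound into an open disc. The index \<open>j\<close> makes the disc of radius
    \<open>r\<close> fit into the half-plane.\<close>
  define r where "r = 2 * (C / koebe_radius + 1)"
  have r: "0 < r" using C koebe_radius_pos by (simp add: r_def add_pos_pos)
  obtain j :: nat where j: "2 * r < real j" using reals_Archimedean2 by blast
  have sub: "cball (wn j) r \<subseteq> {w. Re w < M}"
  proof
    fix x assume "x \<in> cball (wn j) r"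
    then show "x \<in> {w. Re w < M}"
      using complex_Re_le_cmod[of "x - wn j"] Re_wn(1)[of j] j by (simp add: dist_norm norm_minus_commute)
  qed
  have "compact (\<psi> ` cball (wn j) r)"
    by (intro compact_continuous_image holomorphic_on_imp_continuous_on holomorphic_on_subset[OF \<psi>_hol_M sub]) simp
  moreover have "\<psi> ` cball (wn j) r \<subseteq> W" using sub A_sub_W by (auto simp: A_def)
  ultimately obtain k where "iterate (newton_map f) k ` \<psi> ` cball (wn j) r \<subseteq> Some ` B"
    using absorb by (auto simp: weakly_absorbing_def)
  then have k: "(nm ^^ k) (\<psi> u) \<in> B" if "u \<in> cball (wn j) r" for u
    using that iterate_nm[of "\<psi> u" k] A_sub_W sub by (force simp: A_def)
  have *: "ball (zn n) (C * dn n) \<subseteq> B" if n: "n \<ge> k + j"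
    and disc: "\<And>z. dist (zn n) z \<le> C * dn n \<Longrightarrow> z \<in> A \<and> dist (wn n) (g z) \<le> C / koebe_radius" for n
  proof
    fix z assume "z \<in> ball (zn n) (C * dn n)"
    then have z: "z \<in> A" "dist (wn n) (g z) \<le> C / koebe_radius" using disc[of z] by auto
    define m where "m = n - j"
    have m: "n = m + j" "k \<le> m" using n by (auto simp: m_def)
    have wn: "wn n = (h ^^ m) (wn j)" by (simp add: wn_def m(1) funpow_add)
    have "ball ((h ^^ m) (wn j)) (1/2 * r) \<subseteq> (h ^^ m) ` cball (wn j) r"
      by (rule ball_subset_image_expanding[OF open_halfspace_Re_lt iter_holomorphic sub r])
         (use iter_expand in \<open>auto simp: dist_norm\<close>)
    moreover have "g z \<in> ball (wn n) (1/2 * r)" using z(2) by (simp add: r_def)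
    ultimately obtain u where u: "u \<in> cball (wn j) r" "g z = (h ^^ m) u" using wn by auto
    have "z = \<psi> (g z)" using z(1) S_E(2) A_sub_S by (metis subsetD)
    also have "\<dots> = (nm ^^ m) (\<psi> u)" using nm_iter_\<psi>[of u m] u sub by auto
    also have "\<dots> = (nm ^^ (m - k)) ((nm ^^ k) (\<psi> u))" using m(2) by (simp flip: funpow_add comp_apply[of "nm ^^ (m - k)"])
    also have "\<dots> \<in> B" by (rule nm_iter_B[OF k[OF u(1)]])
    finally show "z \<in> B" .
  qed
  show ?thesis
    using orbit_disc[OF C] eventually_ge_at_top[of "k + j"] by eventually_elim (rule *, auto)
qed

lemma deriv_nm_zn:
  assumes \<eta>: "0 < \<eta>"
  shows "\<forall>\<^sub>F n in sequentially. 1 - \<eta> \<le> norm (deriv nm (zn n))"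
proof -
  have "\<forall>\<^sub>F n in sequentially. \<kappa> / \<eta> < real n"
    using filterlim_real_sequentially unfolding filterlim_at_top_dense by blast
  then show ?thesis
  proof eventually_elim
    case (elim n)
    have zS: "zn n \<in> S" using \<psi>_in_S[OF Re_wn(3)] by (simp add: zn_def)
    have n: "0 < real n" using elim \<kappa>_facts(1) \<eta> by (smt (verit) divide_pos_pos)
    have "deriv nm (zn n) = deriv \<nu> (zn n)"
      by (rule deriv_cong_ev) (use zS open_S newton_map_S in \<open>auto simp: eventually_nhds nm_def\<close>)
    then have "norm (deriv nm (zn n) - 1) \<le> 8 / koebe_radius\<^sup>2 / (L - Re (wn n))"
      using deriv_\<nu>_estimate[OF Re_wn(3)] by (simp add: zn_def)
    also have "\<dots> \<le> 8 / koebe_radius\<^sup>2 / (n / 2)"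
      using R_wn[of n] n by (intro divide_left_mono mult_pos_pos) auto
    also have "\<dots> = \<kappa> / 2 / n" by (simp add: \<kappa>_facts(2))
    also have "\<dots> \<le> \<eta>" using elim n \<eta> \<kappa>_facts(1) by (simp add: field_simps)
    finally show ?case using norm_triangle_ineq2[of 1 "1 - deriv nm (zn n)"] by (simp add: norm_minus_commute)
  qed
qed

text \<open>Differentiate \<open>(nm ^^ m) \<circ> \<psi> = \<psi> \<circ> (h ^^ m)\<close> at
  \<open>wn n\<close>; the derivative of \<open>h ^^ m\<close> has modulus at most 2. Iterates thus
  stretch by no more than the step lengths grow, up to this factor.\<close>

lemma norm_deriv_iter_zn: "norm (deriv (nm ^^ m) (zn n)) * dn n \<le> 2 * dn (m + n)"
proof -
  let ?w = "wn n"
  have opP: "open {w. Re w < M}" by (rule open_halfspace_Re_lt)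
  have fd: "\<psi> field_differentiable at w" if "Re w < M" for w
    using holomorphic_on_imp_differentiable_at[OF \<psi>_hol_M opP] that by simp
  have "deriv ((nm ^^ m) \<circ> \<psi>) ?w = deriv (nm ^^ m) (zn n) * deriv \<psi> ?w"
    unfolding zn_def
    by (rule deriv_chain[OF fd[OF Re_wn(2)]])
       (use holomorphic_on_imp_differentiable_at[OF nm_iter_hol open_W] zn_in_W in \<open>simp add: zn_def\<close>)
  moreover have "deriv ((nm ^^ m) \<circ> \<psi>) ?w = deriv (\<psi> \<circ> (h ^^ m)) ?w"
    by (rule deriv_cong_ev) (use nm_iter_\<psi> opP Re_wn(2) in \<open>auto simp: eventually_nhds\<close>)
  moreover have "deriv (\<psi> \<circ> (h ^^ m)) ?w = deriv \<psi> (wn (m + n)) * deriv (h ^^ m) ?w"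
  proof -
    have "(h ^^ m) ?w = wn (m + n)" by (simp add: wn_def funpow_add)
    then show ?thesis
      using deriv_chain[OF holomorphic_on_imp_differentiable_at[OF iter_holomorphic[of m] opP], of ?w \<psi>]
        fd[OF Re_wn(2), of "m + n"] Re_wn(2)[of n]
      by simp
  qed
  ultimately have "norm (deriv (nm ^^ m) (zn n)) * dn n = dn (m + n) * norm (deriv (h ^^ m) ?w)"
    by (simp add: dn_def flip: norm_mult)
  also have "\<dots> \<le> dn (m + n) * 2"
    using norm_deriv_iter_le[OF Re_wn(2)] dn_pos by (intro mult_left_mono) (auto intro: less_imp_le)
  finally show ?thesis by simp
qed

lemma hyperbolic_case:
  assumes ne: "B \<noteq> UNIV" and K: "compact K" "z0 \<in> K" "K \<subseteq> W"
  shows "\<exists>n. (nm ^^ n) ` K \<subseteq> A"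
proof -
  obtain k where "iterate (newton_map f) k ` K \<subseteq> Some ` B"
    using absorb K by (auto simp: weakly_absorbing_def)
  then have kK: "(nm ^^ k) ` K \<subseteq> B" using iterate_nm[of _ k] K(3) by force
  have KB: "(nm ^^ n) x \<in> B" if "n \<ge> k" "x \<in> K" for n x
  proof -
    have "(nm ^^ n) x = (nm ^^ (n - k)) ((nm ^^ k) x)" using that(1) by (simp flip: funpow_add comp_apply[of "nm ^^ (n - k)"])
    then show ?thesis using nm_iter_B kK that(2) by auto
  qed
  have z0n: "(nm ^^ n) z0 = zn n" for n using nm_iter_zn[of n 0] zn_0 by simp
  have znB: "zn n \<in> B" if "n \<ge> k" for n using KB[OF that K(2)] z0n by simp
  have "\<forall>n. \<exists>p q. n \<ge> k \<longrightarrow> riemann_pair B (zn n) p q"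
    using riemann_pair_exists[OF open_B B_sc ne] znB by blast
  then obtain p q where pq: "\<And>n. n \<ge> k \<Longrightarrow> riemann_pair B (zn n) (p n) (q n)" by metis
  note pqD = riemann_pairD[OF pq]
  define G where "G n = q (Suc n) \<circ> nm \<circ> p n" for n
  have G: "G n holomorphic_on ball 0 1" "G n ` ball 0 1 \<subseteq> ball 0 1" "G n 0 = 0" if n: "n \<ge> k" for n
  proof -
    have n': "Suc n \<ge> k" using n by simp
    have im: "nm (p n u) \<in> B" if "u \<in> ball 0 1" for u using nm_B pqD(3)[OF n] that by blast
    have nmB: "nm holomorphic_on B" by (rule holomorphic_on_subset[OF nm_hol B_sub_W])
    have "nm \<circ> p n holomorphic_on ball 0 1"
      by (rule holomorphic_on_compose_gen[OF pqD(1)[OF n] nmB pqD(3)[OF n]])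
    then have "q (Suc n) \<circ> (nm \<circ> p n) holomorphic_on ball 0 1"
      by (rule holomorphic_on_compose_gen[OF _ pqD(2)[OF n']]) (use im in auto)
    then show "G n holomorphic_on ball 0 1" by (simp only: G_def o_assoc)
    show "G n ` ball 0 1 \<subseteq> ball 0 1" using im pqD(4)[OF n'] by (fastforce simp: G_def)
    show "G n 0 = 0" using pqD(7)[OF n] pqD(8)[OF n'] nm_zn by (simp add: G_def)
  qed
  have q_step: "q (Suc n) ((nm ^^ Suc n) x) = G n (q n ((nm ^^ n) x))" if "n \<ge> k" "(nm ^^ n) x \<in> B" for n x
    using pqD(6)[OF that] by (simp add: G_def)
  have schwarz: "norm (G n u) \<le> norm u" if "n \<ge> k" "norm u < 1" for n u
    using Schwarz_Lemma(1)[OF G(1)[OF that(1)] G(3)[OF that(1)] _ that(2)] G(2)[OF that(1)]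
    by (simp add: image_subset_iff)
  \<comment> \<open>By compactness the image of \<open>K\<close> lies in a smaller disc of the
    Riemann coordinate, and Schwarz's lemma for the maps \<open>G n\<close> keeps it there.\<close>
  obtain \<rho>1 where \<rho>1: "0 \<le> \<rho>1" "\<rho>1 < 1" "\<And>x. x \<in> K \<Longrightarrow> norm (q k ((nm ^^ k) x)) \<le> \<rho>1"
  proof -
    let ?F = "\<lambda>x. norm (q k ((nm ^^ k) x))"
    have "continuous_on K ((nm ^^ k))"
      using holomorphic_on_imp_continuous_on[OF holomorphic_on_subset[OF nm_iter_hol K(3)]] .
    moreover have "continuous_on ((nm ^^ k) ` K) (q k)"
      using holomorphic_on_imp_continuous_on[OF holomorphic_on_subset[OF pqD(2)[OF order.refl] kK]] .
    ultimately have "continuous_on K (q k \<circ> (nm ^^ k))" by (rule continuous_on_compose)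
    then have "continuous_on K ?F" by (auto intro: continuous_on_norm simp: o_def)
    then obtain y where y: "y \<in> K" "\<And>x. x \<in> K \<Longrightarrow> ?F x \<le> ?F y"
      using continuous_attains_sup[OF K(1)] K(2) by blast
    moreover have "?F y < 1" using pqD(4)[OF order.refl] kK y(1) by (fastforce)
    ultimately show thesis using that[of "?F y"] by simp
  qed
  have qK: "norm (q n ((nm ^^ n) x)) \<le> \<rho>1" if "n \<ge> k" "x \<in> K" for n x
    using that(1)
  proof (induction n rule: dec_induct)
    case (step n)
    have "norm (q (Suc n) ((nm ^^ Suc n) x)) = norm (G n (q n ((nm ^^ n) x)))"
      using q_step[OF step(1) KB[OF step(1) that(2)]]
      by simp
    also have "\<dots> \<le> norm (q n ((nm ^^ n) x))" using step \<rho>1 by (intro schwarz) auto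
    finally show ?case using step by simp
  qed (use \<rho>1 that in auto)
  \<comment> \<open>Univalence is obtained on the radius \<open>\<rho>\<close>, strictly beyond
    \<open>\<rho>1\<close>, so that the growth theorem applies at the ratio
    \<open>\<rho>1 / \<rho>\<close>.\<close>
  define \<rho> where "\<rho> = (1 + \<rho>1) / 2"
  have \<rho>: "0 < \<rho>" "\<rho> < 1" "\<rho>1 < \<rho>" using \<rho>1 by (auto simp: \<rho>_def)
  obtain \<epsilon> where \<epsilon>: "0 < \<epsilon>" "\<And>G. \<lbrakk>G holomorphic_on ball 0 1; G 0 = 0; G ` ball 0 1 \<subseteq> ball 0 1;
      1 - \<epsilon> \<le> norm (deriv G 0)\<rbrakk> \<Longrightarrow> inj_on G (ball 0 \<rho>)"
    using near_rotation_injective[OF \<rho>(1,2)] by blast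
  let ?C = "32 * growth_bound (1/2)"
  have C: "0 < ?C" using growth_bound_pos by simp
  \<comment> \<open>Small enough that \<open>(1 - \<eta>) / (1 + ?C * \<eta>)\<close> is at least
    \<open>1 - \<epsilon>\<close>, within the range allowed by \<open>renormalized_deriv_ge\<close>.
    A Newton step is \<open>\<eta>\<close> times the radius of a disc of \<open>1 / \<eta>\<close>
    step lengths, which eventually lies in \<open>B\<close>.\<close>
  define \<eta> where "\<eta> = min (1/4) (\<epsilon> / (1 + ?C))"
  have \<eta>: "0 < \<eta>" "\<eta> \<le> 1/4" "\<eta> * (1 + ?C) \<le> \<epsilon>"
    using \<epsilon>(1) C by (auto simp: \<eta>_def min_def divide_simps)
  have \<eta>': "0 < 1 / \<eta>" using \<eta> by simp
  have "\<forall>\<^sub>F n in sequentially. inj_on (G n) (ball 0 \<rho>)"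
    using orbit_disc_in_B[OF \<eta>'] deriv_nm_zn[OF \<eta>(1)] eventually_ge_at_top[of k]
  proof eventually_elim
    case (elim n)
    have n: "n \<ge> k" using elim by simp
    have "(1 - \<eta>) / (1 + ?C * \<eta>) \<le> norm (deriv (G n) 0)"
      unfolding G_def
    proof (rule renormalized_deriv_ge[OF open_B _ _ pq[OF n]])
      show "nm holomorphic_on B" by (rule holomorphic_on_subset[OF nm_hol B_sub_W])
      show "nm ` B \<subseteq> B" using nm_B by blast
      show "riemann_pair B (nm (zn n)) (p (Suc n)) (q (Suc n))" using pq[of "Suc n"] n nm_zn by simp
      show "ball (zn n) (1 / \<eta> * dn n) \<subseteq> B" using elim by simp
      show "dist (zn n) (nm (zn n)) \<le> \<eta> * (1 / \<eta> * dn n)" using \<eta> by (simp add: nm_zn dist_zn)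
    qed (use \<eta> dn_pos elim in auto)
    moreover have "1 - \<epsilon> \<le> (1 - \<eta>) / (1 + ?C * \<eta>)"
    proof -
      have "(1 - \<epsilon>) * (1 + ?C * \<eta>) = 1 - \<epsilon> + ?C * \<eta> - \<epsilon> * (?C * \<eta>)" by (simp add: algebra_simps)
      also have "\<dots> \<le> 1 - \<epsilon> + ?C * \<eta>" using \<epsilon> C \<eta> by simp
      also have "\<dots> \<le> 1 - \<eta>" using \<eta>(3) by (simp add: algebra_simps)
      finally show ?thesis using C \<eta> by (simp add: pos_le_divide_eq add_pos_pos)
    qed
    ultimately show ?case by (intro \<epsilon>(2) G[OF n]) linarith
  qed
  then obtain n1 where n1: "n1 \<ge> k" "\<And>n. n \<ge> n1 \<Longrightarrow> inj_on (G n) (ball 0 \<rho>)"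
    unfolding eventually_sequentially by (metis le_cases order.trans)
  let ?p = "p n1"
  have pB: "?p u \<in> B" if "u \<in> ball 0 1" for u using pqD(3)[OF n1(1)] that by blast
  \<comment> \<open>On the disc this is the composition of the maps \<open>G n\<close> from
    \<open>n1\<close> on. Each factor is injective on \<open>ball 0 \<rho>\<close> and maps this
    disc into itself, so the composition is injective there.\<close>
  define Q where "Q m = q (m + n1) \<circ> (nm ^^ m) \<circ> ?p" for m
  have Q: "inj_on (Q m) (ball 0 \<rho>) \<and> (\<forall>u\<in>ball 0 1. norm (Q m u) \<le> norm u)" for m
  proof (induction m)
    case 0
    have "Q 0 u = u" if "u \<in> ball 0 1" for u using pqD(5)[OF n1(1) that] by (simp add: Q_def)
    then show ?case using \<rho> by (auto simp: inj_on_def)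
  next
    case (Suc m)
    have m: "m + n1 \<ge> k" using n1(1) by simp
    have QS: "Q (Suc m) u = G (m + n1) (Q m u)" if "u \<in> ball 0 1" for u
      using pqD(6)[OF m nm_iter_B[OF pB[OF that], of m]] by (simp add: Q_def G_def)
    have "inj_on (G (m + n1) \<circ> Q m) (ball 0 \<rho>)"
    proof (rule comp_inj_on)
      have "Q m ` ball 0 \<rho> \<subseteq> ball 0 \<rho>"
      proof clarify
        fix u :: complex assume "u \<in> ball 0 \<rho>"
        then have "norm u < \<rho>" "norm (Q m u) \<le> norm u" using Suc \<rho> by auto
        then show "Q m u \<in> ball 0 \<rho>" by simp
      qed
      then show "inj_on (G (m + n1)) (Q m ` ball 0 \<rho>)" using n1(2)[of "m + n1"] by (simp add: inj_on_subset)
    qed (use Suc in simp)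
    moreover have "inj_on (Q (Suc m)) (ball 0 \<rho>) = inj_on (G (m + n1) \<circ> Q m) (ball 0 \<rho>)"
      by (rule inj_on_cong) (use QS \<rho> in auto)
    moreover have "norm (Q (Suc m) u) \<le> norm u" if u: "u \<in> ball 0 1" for u
      using QS[OF u] schwarz[OF m, of "Q m u"] Suc u by fastforce
    ultimately show ?case by blast
  qed
  \<comment> \<open>Without the last Riemann coordinate, \<open>F m\<close> measures Euclidean
    distance in the plane. It inherits injectivity from \<open>Q m\<close>, which factors through
    it.\<close>
  define F where "F m = (nm ^^ m) \<circ> ?p" for m
  have Fhol: "F m holomorphic_on ball 0 1" for m
    unfolding F_def using holomorphic_on_compose_gen[OF pqD(1)[OF n1(1)] nm_iter_hol] pB B_sub_W by blast
  have Finj: "inj_on (F m) (ball 0 \<rho>)" for m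
  proof (rule inj_onI)
    fix x y assume "x \<in> ball 0 \<rho>" "y \<in> ball 0 \<rho>" "F m x = F m y"
    moreover from this have "Q m x = Q m y" by (simp add: F_def Q_def)
    ultimately show "x = y" using Q[of m] by (auto dest: inj_onD)
  qed
  have F0: "F m 0 = zn (m + n1)" for m using pqD(7)[OF n1(1)] nm_iter_zn by (simp add: F_def)
  \<comment> \<open>The growth bound for \<open>F m\<close> combined with
    \<open>norm_deriv_iter_zn\<close>, in units of \<open>dn (m + n1)\<close>; the added 1 makes it
    positive for \<open>orbit_disc\<close>.\<close>
  define C0 where "C0 = growth_bound (\<rho>1 / \<rho>) * \<rho> * (2 * norm (deriv ?p 0) / dn n1) + 1"
  have "deriv (F m) 0 = deriv (nm ^^ m) (zn n1) * deriv ?p 0" for m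
    using deriv_chain[OF holomorphic_on_imp_differentiable_at[OF pqD(1)[OF n1(1)] open_ball]
        holomorphic_on_imp_differentiable_at[OF nm_iter_hol open_W], of 0 m] pqD(7)[OF n1(1)] zn_in_W
    by (simp add: F_def)
  then have dF: "norm (deriv (F m) 0) \<le> 2 * norm (deriv ?p 0) / dn n1 * dn (m + n1)" for m
    using mult_right_mono[OF norm_deriv_iter_zn[of m n1] norm_ge_zero[of "deriv ?p 0"]] dn_pos[of n1]
    by (simp add: norm_mult divide_simps mult_ac)
  have near: "dist (zn (m + n1)) ((nm ^^ (m + n1)) x) \<le> C0 * dn (m + n1)" if x: "x \<in> K" for m x
  proof -
    let ?u = "q n1 ((nm ^^ n1) x)"
    have u: "norm ?u \<le> \<rho>1" by (rule qK[OF n1(1) x])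
    have "(nm ^^ (m + n1)) x = F m ?u" using pqD(6)[OF n1(1) KB[OF n1(1) x]] by (simp add: F_def funpow_add)
    moreover have "dist (F m 0) (F m ?u) \<le> growth_bound (\<rho>1 / \<rho>) * \<rho> * norm (deriv (F m) 0)"
      by (rule koebe_growth[OF holomorphic_on_subset[OF Fhol] Finj]) (use \<rho> \<rho>1 u in auto)
    moreover have "\<dots> \<le> growth_bound (\<rho>1 / \<rho>) * \<rho> * (2 * norm (deriv ?p 0) / dn n1 * dn (m + n1))"
      using dF growth_bound_pos[of "\<rho>1 / \<rho>"] \<rho> by (intro mult_left_mono) auto
    ultimately show ?thesis using dn_pos[of "m + n1"] by (simp add: F0 C0_def algebra_simps)
  qed
  have "0 < C0" unfolding C0_def
    using growth_bound_pos[of "\<rho>1 / \<rho>"] \<rho> dn_pos[of n1] by (intro add_nonneg_pos mult_nonneg_nonneg divide_nonneg_pos) auto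
  from orbit_disc[OF this] obtain n2 where n2: "\<And>n z. \<lbrakk>n \<ge> n2; dist (zn n) z \<le> C0 * dn n\<rbrakk> \<Longrightarrow> z \<in> A"
    unfolding eventually_sequentially by blast
  have "(nm ^^ (n2 + n1)) ` K \<subseteq> A" using n2[OF _ near, of n2] by auto
  then show ?thesis by blast
qed

lemma absorbed_by_A:
  assumes "compact K" "connected K" "z0 \<in> K" "K \<subseteq> W"
  shows "\<exists>n. iterate (newton_map f) n ` K \<subseteq> Some ` A"
proof -
  obtain n where "(nm ^^ n) ` K \<subseteq> A"
    using entire_case[OF _ assms(1-3)] hyperbolic_case[OF _ assms(1,3,4)] by blast
  then show ?thesis using iterate_nm[of _ n] assms(4) by (intro exI[of _ n]) force
qed

end

section \<open>From a universal covering of the punctured disc to a half-plane coordinate\<close>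

lemma exp_in_punctured_ball:
  assumes "0 < r" "Re w < ln r"
  shows "exp w \<in> ball 0 r - {0}"
proof -
  have "exp (Re w) < exp (ln r)" using assms(2) by simp
  then show ?thesis using assms(1) by simp
qed

text \<open>Both \<open>f\<close> on \<open>X\<close> and \<open>exp\<close> on the half-plane are
  universal coverings of the punctured disc. Lifting \<open>exp\<close> through \<open>f\<close>
  gives \<open>\<psi>\<close>, lifting \<open>f\<close> through \<open>exp\<close> gives
  \<open>g\<close>, and uniqueness of lifts makes them mutually inverse once they agree at a base
  point.\<close>

lemma log_tract_of_universal_covering:
  assumes f: "f holomorphic_on UNIV" and r: "0 < r"
    and X: "X \<in> components (f -` ball 0 r)"
    and cov: "universal_covering X f (ball 0 r - {0})"
  obtains \<psi> where "log_tract f \<psi> (ln r)" "\<psi> ` {w. Re w < ln r} = X"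
proof -
  let ?H = "{w. Re w < ln r}"
  have cov': "covering_space X f (ball 0 r - {0})" and sc: "simply_connected X" and conn: "connected X"
    using cov by (auto simp: universal_covering_def)
  have cf: "continuous_on UNIV f" by (rule holomorphic_on_imp_continuous_on[OF f])
  have openX: "open X"
    using open_components[OF continuous_open_vimage[OF open_ball] X] cf by (simp add: continuous_on_eq_continuous_at)
  have fX: "f z \<in> ball 0 r - {0}" if "z \<in> X" for z
    using covering_space_imp_surjective[OF cov'] that by blast
  have expH: "exp \<in> ?H \<rightarrow> ball 0 r - {0}" using exp_in_punctured_ball[OF r] by blast
  have convH: "convex ?H" by (rule convex_halfspace_Re_lt)
  obtain \<psi> where \<psi>: "continuous_on ?H \<psi>" "\<psi> \<in> ?H \<rightarrow> X" "\<And>w. w \<in> ?H \<Longrightarrow> f (\<psi> w) = exp w"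
    using covering_space_lift[OF cov' convex_imp_simply_connected[OF convH]
        convex_imp_locally_path_connected[OF convH] continuous_on_exp[OF continuous_on_id] expH] by auto
  have \<psi>_hol: "\<psi> holomorphic_on ?H"
    by (rule covering_space_lift_is_holomorphic[OF cov' openX holomorphic_on_subset[OF f] _ expH \<psi>(2,1)])
       (use \<psi>(3) in \<open>auto intro: holomorphic_intros\<close>)
  obtain g0 where g0: "continuous_on X g0" "\<And>z. z \<in> X \<Longrightarrow> exp (g0 z) = f z"
    using covering_space_lift[OF covering_space_exp_punctured_plane sc open_imp_locally_path_connected[OF openX]
        continuous_on_subset[OF cf]] fX by (metis DiffE Pi_I Compl_iff subset_UNIV)
  define w1 :: complex where "w1 = of_real (ln r - 1)"
  have w1: "w1 \<in> ?H" by (simp add: w1_def)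
  \<comment> \<open>The subtracted constant is a period of \<open>exp\<close>, so \<open>g\<close>
    is still a logarithm of \<open>f\<close>, now normalised by
    \<open>g (\<psi> w1) = w1\<close>.\<close>
  define g where "g z = g0 z - (g0 (\<psi> w1) - w1)" for z
  have x1: "\<psi> w1 \<in> X" using \<psi>(2) w1 by blast
  have "exp (g0 (\<psi> w1) - w1) = 1" using g0(2)[OF x1] \<psi>(3)[OF w1] by (simp add: exp_diff)
  then have exp_g: "exp (g z) = f z" if "z \<in> X" for z
    using g0(2)[OF that] by (simp add: g_def exp_diff[of "g0 z"])
  have g: "continuous_on X g" unfolding g_def by (intro continuous_intros g0(1))
  have g_H: "g z \<in> ?H" if "z \<in> X" for z
  proof -
    have "exp (Re (g z)) < exp (ln r)" using fX[OF that] exp_g[OF that] r by (metis DiffE dist_0_norm exp_ln mem_ball norm_exp_eq_Re)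
    then show ?thesis by simp
  qed
  have g\<psi>: "g (\<psi> w) = w" if w: "w \<in> ?H" for w
  proof -
    have "(g \<circ> \<psi>) w = id w"
    proof (rule covering_space_lift_unique[OF covering_space_exp_punctured_plane, of "g \<circ> \<psi>" w1 id ?H exp w])
      show "(g \<circ> \<psi>) w1 = id w1" by (simp add: g_def)
      show "continuous_on ?H (g \<circ> \<psi>)"
        by (rule continuous_on_compose[OF \<psi>(1) continuous_on_subset[OF g]]) (use \<psi>(2) in auto)
      show "exp x = exp ((g \<circ> \<psi>) x)" if "x \<in> ?H" for x
        using exp_g[of "\<psi> x"] \<psi>(2,3) that by (simp add: Pi_iff)
    qed (use w w1 convex_connected[OF convH] in \<open>auto intro!: continuous_intros\<close>)
    then show ?thesis by simp
  qed
  have \<psi>g: "\<psi> (g z) = z" if z: "z \<in> X" for z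
  proof -
    have "(\<psi> \<circ> g) z = id z"
    proof (rule covering_space_lift_unique[OF cov', of "\<psi> \<circ> g" "\<psi> w1" id X f z])
      show "(\<psi> \<circ> g) (\<psi> w1) = id (\<psi> w1)" using g\<psi>[OF w1] by simp
      show "continuous_on X (\<psi> \<circ> g)"
        by (rule continuous_on_compose[OF g continuous_on_subset[OF \<psi>(1)]]) (use g_H in blast)
      show "f x = f ((\<psi> \<circ> g) x)" if "x \<in> X" for x
        using \<psi>(3)[OF g_H[OF that]] exp_g[OF that] by simp
      show "\<psi> \<circ> g \<in> X \<rightarrow> X" using \<psi>(2) g_H by fastforce
      show "f \<in> X \<rightarrow> ball 0 r - {0}" using fX by blast
      show "continuous_on X f" by (rule continuous_on_subset[OF cf]) simp
    qed (use z x1 conn in \<open>auto intro!: continuous_intros\<close>)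
    then show ?thesis by simp
  qed
  have im: "\<psi> ` ?H = X"
  proof
    show "X \<subseteq> \<psi> ` ?H" using \<psi>g g_H by (metis image_eqI subsetI)
  qed (use \<psi>(2) in auto)
  have "log_tract f \<psi> (ln r)"
  proof
    show "f holomorphic_on UNIV" "\<psi> holomorphic_on ?H" by fact+
    show "inj_on \<psi> ?H" using g\<psi> by (rule inj_on_inverseI)
    show "f (\<psi> w) = exp w" if "Re w < ln r" for w using \<psi>(3) that by simp
    \<comment> \<open>The closure is connected, meets \<open>X\<close>, and satisfies
      \<open>norm (f z) \<le> exp L' < r\<close>, so it lies in the component \<open>X\<close> of
      the preimage.\<close>
    fix L' assume L': "L' < ln r"
    let ?Y = "\<psi> ` {w. Re w < L'}"
    have sub: "{w. Re w < L'} \<subseteq> ?H" using L' by auto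
    have "connected ?Y"
      by (intro connected_continuous_image continuous_on_subset[OF \<psi>(1) sub] convex_connected convex_halfspace_Re_lt)
    then have "connected (closure ?Y)" by (rule connected_imp_connected_closure)
    moreover have "closure ?Y \<subseteq> f -` ball 0 r"
    proof -
      have "closed {z. norm (f z) \<le> exp L'}" using cf by (intro closed_Collect_le continuous_intros) auto
      moreover have "?Y \<subseteq> {z. norm (f z) \<le> exp L'}" using \<psi>(3) sub by force
      ultimately have "closure ?Y \<subseteq> {z. norm (f z) \<le> exp L'}" by (rule closure_minimal[rotated])
      moreover have "exp L' < r" using L' r by (metis exp_less_cancel_iff exp_ln)
      ultimately show ?thesis by auto
    qed
    moreover have "X \<inter> closure ?Y \<noteq> {}"
    proof -
      have "\<psi> (of_real (L' - 1)) \<in> ?Y" by auto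
      moreover have "?Y \<subseteq> X" using sub im by blast
      ultimately show ?thesis using closure_subset[of ?Y] by blast
    qed
    ultimately show "closure ?Y \<subseteq> \<psi> ` ?H" unfolding im by (intro components_maximal[OF X])
  qed
  then show ?thesis using im that by blast
qed

section \<open>Assembly of the basin and identification of the absorbing tract\<close>

context log_tract
begin

lemma parabolic_basin: "parabolic_type_I_basin (newton_map f) seed.V"
  unfolding parabolic_type_I_basin_def virtual_immediate_basin_def
proof (intro conjI allI impI conformal_conjugacy_plane)
  show "pre_virtual_basin (newton_map f) seed.V"
    unfolding pre_virtual_basin_def
    using seed.V_domain seed.V_tends A_tends absorbing_A by blast
  fix W assume W: "pre_virtual_basin (newton_map f) W \<and> seed.V \<subseteq> W"
  then obtain B where B: "absorbing (newton_map f) W B" by (auto simp: pre_virtual_basin_def)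
  interpret larger_basin f \<psi> L W B
    by unfold_locales
       (use W B seed.A_sub_V in \<open>auto simp: pre_virtual_basin_def absorbing_def\<close>)
  show "W = seed.V"
    by (rule seed.V_maximal) (use W absorbed_by_A in \<open>auto simp: pre_virtual_basin_def\<close>)
qed

end

theorem theorem4p1:
  fixes f :: "complex \<Rightarrow> complex" and U :: "real \<Rightarrow> complex set"
  assumes "f holomorphic_on UNIV"
    and "logarithmic_singularity f 0 U"
  shows "\<exists>r0>0. \<exists>V. parabolic_type_I_basin (newton_map f) V \<and> absorbing (newton_map f) V (U r0)"
proof -
  have sing: "singularity_over f 0 U"
    and ev: "\<forall>\<^sub>F r in at_right 0. universal_covering (U r) f (ball 0 r - {0})"
    using assms(2) by (auto simp: logarithmic_singularity_def direct_singularity_def)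
  obtain r1 where r1: "0 < r1" "\<And>r. \<lbrakk>0 < r; r < r1\<rbrakk> \<Longrightarrow> universal_covering (U r) f (ball 0 r - {0})"
    using ev by (auto simp: eventually_at_right_field)
  define r where "r = r1 / 2"
  have r: "0 < r" "universal_covering (U r) f (ball 0 r - {0})" using r1 by (auto simp: r_def)
  have comp: "U s \<in> components (f -` ball 0 s)" if "0 < s" for s
    using sing that by (auto simp: singularity_over_def)
  obtain \<psi> where \<psi>: "log_tract f \<psi> (ln r)" "\<psi> ` {w. Re w < ln r} = U r"
    using log_tract_of_universal_covering[OF assms(1) r(1) comp[OF r(1)] r(2)] .
  interpret log_tract f \<psi> "ln r" by (rule \<psi>(1))
  have UrS: "U r = S" using \<psi>(2) by (simp add: S_def)
  have lt: "exp M < r" using M_less r(1) by (metis exp_less_cancel_iff exp_ln)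
  \<comment> \<open>Nestedness puts \<open>U (exp M)\<close> inside the tract \<open>S\<close>,
    where \<open>norm (f z) < exp M\<close> means membership in \<open>A\<close>. Conversely
    \<open>A\<close> is connected, lies in the preimage of the smaller disc and meets its component
    \<open>U (exp M)\<close>.\<close>
  have "U (exp M) = A"
  proof
    have "U (exp M) \<subseteq> U r" using sing lt by (auto simp: singularity_over_def)
    moreover have "U (exp M) \<subseteq> f -` ball 0 (exp M)" using in_components_subset[OF comp] by simp
    ultimately show *: "U (exp M) \<subseteq> A"
      using f_S(1) by (fastforce simp: in_A_iff UrS)
    have "U (exp M) \<noteq> {}" using in_components_nonempty[OF comp] by simp
    then have "U (exp M) \<inter> A \<noteq> {}" using * by blast
    moreover have "A \<subseteq> f -` ball 0 (exp M)" using f_S(1) by (auto simp: in_A_iff)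
    ultimately show "A \<subseteq> U (exp M)"
      using components_maximal[OF comp seed.A_conn] by simp
  qed
  then show ?thesis using parabolic_basin absorbing_A by (intro exI[of _ "exp M"]) auto
qed

end
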